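(* If there is a constant number of agents, then there exists a pseudo-polynomial-time algorithm to compute a Pareto optimal and individually rational assignment. That is, for every constant number of agents $n$, there is a pseudo-polynomial-time algorithm which, given objects $O$, additive utilities $u_1,\dots,u_n$ and an initial endowment $e$, computes an assignment that is Pareto optimal and individually rational for $e$.
   Context: $N=\{1,\dots,n\}$ is a set of agents and $O=\{o_1,\dots,o_m\}$ a set of objects. An assignment $p=(p(1),\dots,p(n))$ is a partition of $O$ into $n$ (possibly empty) subsets, $p(i)$ being the bundle of agent $i$; an initial endowment $e$ is an assignment. Each agent $i$ has a utility $u_i(o)\ge 0$ for each object, extended additively: $u_i(S)=\sum_{o\in S}u_i(o)$ for $S\subseteq O$. An assignment $p$ is individually rational for $e$ if $u_i(p(i))\ge u_i(e(i))$ for all $i\in N$. Assignment $q$ Pareto dominates $p$ if $u_i(q(i))\ge u_i(p(i))$ for all $i\in N$ and $u_i(q(i))>u_i(p(i))$ for at least one $i\in N$. An assignment is Pareto optimal if no assignment Pareto dominates it. Pseudo-polynomial time means time polynomial in the size of the input when the numbers in it are encoded in unary. *)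

theory Defs
  imports "HOL-Library.Disjoint_Sets" "HOL-Computational_Algebra.Polynomial"
begin

section \<open>Assignments of indivisible objects\<close>

text \<open>The bundles indexed by \<open>N\<close> partition \<open>O\<close>; bundles may be empty. The values of an
  assignment outside \<open>N\<close> are irrelevant, and no definition below inspects them.\<close>

definition assignment :: "'i set \<Rightarrow> 'o set \<Rightarrow> ('i \<Rightarrow> 'o set) \<Rightarrow> bool" where
  "assignment N Obj p \<longleftrightarrow> disjoint_family_on p N \<and> (\<Union>i\<in>N. p i) = Obj"

text \<open>Utilities are natural numbers, since they have to be written down in unary.\<close>

definition utility :: "('i \<Rightarrow> 'o \<Rightarrow> nat) \<Rightarrow> 'i \<Rightarrow> 'o set \<Rightarrow> nat" where
  "utility u i S = (\<Sum>x\<in>S. u i x)"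

definition individually_rational ::
    "'i set \<Rightarrow> ('i \<Rightarrow> 'o \<Rightarrow> nat) \<Rightarrow> ('i \<Rightarrow> 'o set) \<Rightarrow> ('i \<Rightarrow> 'o set) \<Rightarrow> bool" where
  "individually_rational N u e p \<longleftrightarrow> (\<forall>i\<in>N. utility u i (p i) \<ge> utility u i (e i))"

definition pareto_dominates ::
    "'i set \<Rightarrow> ('i \<Rightarrow> 'o \<Rightarrow> nat) \<Rightarrow> ('i \<Rightarrow> 'o set) \<Rightarrow> ('i \<Rightarrow> 'o set) \<Rightarrow> bool" where
  "pareto_dominates N u q p \<longleftrightarrow>
     (\<forall>i\<in>N. utility u i (q i) \<ge> utility u i (p i)) \<and>
     (\<exists>i\<in>N. utility u i (q i) > utility u i (p i))"

definition pareto_optimal ::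
    "'i set \<Rightarrow> 'o set \<Rightarrow> ('i \<Rightarrow> 'o \<Rightarrow> nat) \<Rightarrow> ('i \<Rightarrow> 'o set) \<Rightarrow> bool" where
  "pareto_optimal N Obj u p \<longleftrightarrow> (\<nexists>q. assignment N Obj q \<and> pareto_dominates N u q p)"

section \<open>Random access machines\<close>

text \<open>
  The model of computation is the random access machine of Cook and Reckhow, with a read-only
  input tape, a write-only output tape and unit cost per instruction. Registers hold natural
  numbers. There is no multiplication: the bit length of the largest number present grows by at
  most one per step, apart from the constants of the program, so that unit-cost time is
  polynomially related to logarithmic-cost time and to Turing machine time.
\<close>

datatype instr =
    Const nat nat     \<comment> \<open>\<open>r\<^sub>a := b\<close>\<close>
  | Add nat nat nat   \<comment> \<open>\<open>r\<^sub>a := r\<^sub>b + r\<^sub>c\<close>\<close>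
  | Sub nat nat nat   \<comment> \<open>\<open>r\<^sub>a := r\<^sub>b - r\<^sub>c\<close>, truncated at 0\<close>
  | Load nat nat      \<comment> \<open>\<open>r\<^sub>a := r[r\<^sub>b]\<close>\<close>
  | Store nat nat     \<comment> \<open>\<open>r[r\<^sub>a] := r\<^sub>b\<close>\<close>
  | Read nat          \<comment> \<open>\<open>r\<^sub>a :=\<close> next input number, or 0 if the input is exhausted\<close>
  | Write nat         \<comment> \<open>append \<open>r\<^sub>a\<close> to the output\<close>
  | Jump nat          \<comment> \<open>continue at instruction \<open>a\<close>\<close>
  | JumpZero nat nat  \<comment> \<open>continue at instruction \<open>b\<close> if \<open>r\<^sub>a = 0\<close>\<close>

type_synonym program = "instr list"

record config =
  pc :: nat
  reg :: "nat \<Rightarrow> nat"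
  inp :: "nat list"
  outp :: "nat list"

fun exec_instr :: "instr \<Rightarrow> config \<Rightarrow> config" where
  "exec_instr (Const a b) s = s\<lparr>pc := pc s + 1, reg := (reg s)(a := b)\<rparr>"
| "exec_instr (Add a b c) s = s\<lparr>pc := pc s + 1, reg := (reg s)(a := reg s b + reg s c)\<rparr>"
| "exec_instr (Sub a b c) s = s\<lparr>pc := pc s + 1, reg := (reg s)(a := reg s b - reg s c)\<rparr>"
| "exec_instr (Load a b) s = s\<lparr>pc := pc s + 1, reg := (reg s)(a := reg s (reg s b))\<rparr>"
| "exec_instr (Store a b) s = s\<lparr>pc := pc s + 1, reg := (reg s)(reg s a := reg s b)\<rparr>"
| "exec_instr (Read a) s =
     s\<lparr>pc := pc s + 1,
       reg := (reg s)(a := (case inp s of [] \<Rightarrow> 0 | x # _ \<Rightarrow> x)),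
       inp := tl (inp s)\<rparr>"
| "exec_instr (Write a) s = s\<lparr>pc := pc s + 1, outp := outp s @ [reg s a]\<rparr>"
| "exec_instr (Jump a) s = s\<lparr>pc := a\<rparr>"
| "exec_instr (JumpZero a b) s = s\<lparr>pc := (if reg s a = 0 then b else pc s + 1)\<rparr>"

definition halted :: "program \<Rightarrow> config \<Rightarrow> bool" where
  "halted P s \<longleftrightarrow> pc s \<ge> length P"

definition step :: "program \<Rightarrow> config \<Rightarrow> config" where
  "step P s = (if halted P s then s else exec_instr (P ! pc s) s)"

definition init_config :: "nat list \<Rightarrow> config" where
  "init_config xs = \<lparr>pc = 0, reg = (\<lambda>_. 0), inp = xs, outp = []\<rparr>"

text \<open>Since a halted configuration no longer changes, this says that the program halts after
  at most \<open>t\<close> steps, with output \<open>ys\<close>.\<close>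

definition computes_within :: "program \<Rightarrow> nat list \<Rightarrow> nat list \<Rightarrow> nat \<Rightarrow> bool" where
  "computes_within P xs ys t \<longleftrightarrow>
     (let s = (step P ^^ t) (init_config xs) in halted P s \<and> outp s = ys)"

definition computes :: "program \<Rightarrow> nat list \<Rightarrow> nat list \<Rightarrow> bool" where
  "computes P xs ys \<longleftrightarrow> (\<exists>t. computes_within P xs ys t)"

text \<open>The size in unary: every number \<open>x\<close> is written as \<open>x\<close> strokes and a delimiter.\<close>

definition unary_size :: "nat list \<Rightarrow> nat" where
  "unary_size xs = (\<Sum>x\<leftarrow>xs. x + 1)"

definition pseudo_polynomial_time_on :: "nat list set \<Rightarrow> program \<Rightarrow> bool" where
  "pseudo_polynomial_time_on X P \<longleftrightarrow>
     (\<exists>b :: nat poly. \<forall>xs\<in>X. \<exists>ys. computes_within P xs ys (poly b (unary_size xs)))"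

lemma halted_stable: "halted P s \<Longrightarrow> (step P ^^ k) s = s"
  by (induction k) (auto simp: step_def)

lemma computes_within_mono:
  assumes "computes_within P xs ys t" and "t \<le> t'"
  shows "computes_within P xs ys t'"
proof -
  have "t' = (t' - t) + t"
    using assms(2) by simp
  then have "(step P ^^ t') (init_config xs) = (step P ^^ (t' - t)) ((step P ^^ t) (init_config xs))"
    by (metis comp_apply funpow_add)
  with assms(1) show ?thesis
    by (simp add: computes_within_def Let_def halted_stable)
qed

lemma computes_unique: "computes P xs ys \<Longrightarrow> computes P xs zs \<Longrightarrow> ys = zs"
  unfolding computes_def
  by (metis (no_types, lifting) computes_within_def computes_within_mono nle_le)

section \<open>Encoding of instances\<close>

text \<open>Agents are \<open>{1..n}\<close> and objects are \<open>{1..m}\<close>. An assignment is written down as the list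
  of the owners of the objects \<open>1, \<dots>, m\<close>. The number \<open>n\<close> is a constant known to the program
  and hence not part of the input.\<close>

definition owner :: "nat \<Rightarrow> (nat \<Rightarrow> nat set) \<Rightarrow> nat \<Rightarrow> nat" where
  "owner n p x = (THE i. i \<in> {1..n} \<and> x \<in> p i)"

definition encode_assignment :: "nat \<Rightarrow> nat \<Rightarrow> (nat \<Rightarrow> nat set) \<Rightarrow> nat list" where
  "encode_assignment n m p = map (owner n p) [1..<m + 1]"

definition encode_instance ::
    "nat \<Rightarrow> nat \<Rightarrow> (nat \<Rightarrow> nat \<Rightarrow> nat) \<Rightarrow> (nat \<Rightarrow> nat set) \<Rightarrow> nat list" where
  "encode_instance n m u e =
     m # concat (map (\<lambda>i. map (u i) [1..<m + 1]) [1..<n + 1]) @ encode_assignment n m e"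

definition instances :: "nat \<Rightarrow> nat list set" where
  "instances n = {encode_instance n m u e | m u e. assignment {1..n} {1..m} e}"

lemma owner_eq_iff:
  assumes "assignment {1..n} {1..m} p" and "x \<in> {1..m}"
  shows "owner n p x = i \<longleftrightarrow> i \<in> {1..n} \<and> x \<in> p i"
proof -
  from assms have "\<exists>!j. j \<in> {1..n} \<and> x \<in> p j"
    unfolding assignment_def disjoint_family_on_def by blast
  from theI'[OF this] this show ?thesis
    unfolding owner_def by blast
qed

end

theory Submission imports Defs begin

text \<open>Let \<open>B\<close> exceed the sum of all utilities, and represent a utility vector \<open>(v\<^sub>0, \<dots>, v\<^sub>n\<^sub>-\<^sub>1)\<close> by
  the number with digits \<open>v\<^sub>i\<close> in base \<open>B\<close>. There are only \<open>B ^ n\<close> such codes, which is polynomial in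
  the unary size of the instance, so the codes that are reachable by distributing the last \<open>k\<close>
  objects can be tabulated for all \<open>k\<close>, with back pointers. Among the codes of the complete
  assignments, select the largest one all of whose digits are at least those of the endowment.
  The code is a positively weighted sum of the utilities, and an assignment that dominates an
  individually rational one is itself individually rational; hence the selected assignment is
  Pareto optimal.\<close>

section \<open>A structured language on top of the random access machine\<close>

text \<open>The obstacle is the machine, which has neither multiplication nor division nor an order
  test. Therefore the rows of the table are laid out one after the other, each with
  \<open>K = B ^ n\<close> columns, so that giving an object to an agent is a plain addition to a
  position; products and remainders come from repeated addition and subtraction. Such loops are
  affordable because all their iteration counts stay below one bound \<open>Z\<close> that is
  polynomial in the unary size. \<open>B\<close> is one more than the sum of the input after
  \<open>m\<close>, so adding weights never carries from one agent's digit into the next.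
  Distributing the objects from the last to the first makes the back pointers return the owners in
  the order in which the output lists them.\<close>

datatype var = vM | vL | vB | vK | vR | vQ | vI | vJ | vX | vY | vZ | vP | vC | vA

datatype arr = aW | aP | aE | aT | aX

primrec var_index :: "var \<Rightarrow> nat" where
  "var_index vM = 0" | "var_index vL = 1" | "var_index vB = 2" | "var_index vK = 3"
| "var_index vR = 4" | "var_index vQ = 5" | "var_index vI = 6" | "var_index vJ = 7"
| "var_index vX = 8" | "var_index vY = 9" | "var_index vZ = 10" | "var_index vP = 11"
| "var_index vC = 12" | "var_index vA = 13"

primrec arr_index :: "arr \<Rightarrow> nat" where
  "arr_index aW = 1" | "arr_index aP = 2" | "arr_index aE = 3" | "arr_index aT = 4"
| "arr_index aX = 5"

text \<open>The registers are split by residue class modulo 8, so that five unbounded arrays and the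
  variables never overlap. Registers 0 and 8 hold intermediate results.\<close>

definition var_reg :: "var \<Rightarrow> nat" where
  "var_reg x = 8 * var_index x + 7"

definition arr_reg :: "arr \<Rightarrow> nat \<Rightarrow> nat" where
  "arr_reg a y = 8 * y + arr_index a"

record state =
  vr :: "var \<Rightarrow> nat"
  ar :: "arr \<Rightarrow> nat \<Rightarrow> nat"
  inq :: "nat list"
  outq :: "nat list"

datatype atom =
    SetC var nat | SetV var var | Inc var | Dec var | AddV var var var | SubV var var var
  | Get var arr var | Put arr var var | Rd var | Wr var

abbreviation set_var :: "state \<Rightarrow> var \<Rightarrow> nat \<Rightarrow> state" where
  "set_var s x k \<equiv> s\<lparr>vr := (vr s)(x := k)\<rparr>"

primrec atom_exec :: "atom \<Rightarrow> state \<Rightarrow> state" where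
  "atom_exec (SetC x k) s = set_var s x k"
| "atom_exec (SetV x y) s = set_var s x (vr s y)"
| "atom_exec (Inc x) s = set_var s x (vr s x + 1)"
| "atom_exec (Dec x) s = set_var s x (vr s x - 1)"
| "atom_exec (AddV x y z) s = set_var s x (vr s y + vr s z)"
| "atom_exec (SubV x y z) s = set_var s x (vr s y - vr s z)"
| "atom_exec (Get x a y) s = set_var s x (ar s a (vr s y))"
| "atom_exec (Put a y x) s = s\<lparr>ar := (ar s)(a := (ar s a)(vr s y := vr s x))\<rparr>"
| "atom_exec (Rd x) s =
     s\<lparr>vr := (vr s)(x := (case inq s of [] \<Rightarrow> 0 | k # _ \<Rightarrow> k)), inq := tl (inq s)\<rparr>"
| "atom_exec (Wr x) s = s\<lparr>outq := outq s @ [vr s x]\<rparr>"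

text \<open>Three doublings multiply the index by 8; the residue of the array is added last.\<close>

definition address_code :: "arr \<Rightarrow> var \<Rightarrow> program" where
  "address_code a y =
     [Add 0 (var_reg y) (var_reg y), Add 0 0 0, Add 0 0 0, Const 8 (arr_index a), Add 0 0 8]"

primrec atom_code :: "atom \<Rightarrow> program" where
  "atom_code (SetC x k) = [Const (var_reg x) k]"
| "atom_code (SetV x y) = [Const 0 0, Add (var_reg x) (var_reg y) 0]"
| "atom_code (Inc x) = [Const 0 1, Add (var_reg x) (var_reg x) 0]"
| "atom_code (Dec x) = [Const 0 1, Sub (var_reg x) (var_reg x) 0]"
| "atom_code (AddV x y z) = [Add (var_reg x) (var_reg y) (var_reg z)]"
| "atom_code (SubV x y z) = [Sub (var_reg x) (var_reg y) (var_reg z)]"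
| "atom_code (Get x a y) = address_code a y @ [Load (var_reg x) 0]"
| "atom_code (Put a y x) = address_code a y @ [Store 0 (var_reg x)]"
| "atom_code (Rd x) = [Read (var_reg x)]"
| "atom_code (Wr x) = [Write (var_reg x)]"

datatype com =
    Atom atom
  | Seq com com  (infixr ";;" 60)
  | If var com com
  | While var com

primrec compile :: "nat \<Rightarrow> com \<Rightarrow> program" where
  "compile p (Atom a) = atom_code a"
| "compile p (c ;; d) = (let C = compile p c in C @ compile (p + length C) d)"
| "compile p (If x c d) =
     (let C = compile (p + 1) c; q = p + length C + 2; D = compile q d
      in JumpZero (var_reg x) q # C @ Jump (q + length D) # D)"
| "compile p (While x c) =
     (let C = compile (p + 1) c
      in JumpZero (var_reg x) (p + length C + 2) # C @ [Jump p])"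

text \<open>The number is the exact count of machine steps of the compiled code, including the jumps
  of branches and loops.\<close>

inductive big :: "com \<Rightarrow> state \<Rightarrow> nat \<Rightarrow> state \<Rightarrow> bool" where
  big_Atom: "big (Atom a) s (length (atom_code a)) (atom_exec a s)"
| big_Seq: "big c s t s' \<Longrightarrow> big d s' t' s'' \<Longrightarrow> big (c ;; d) s (t + t') s''"
| big_If_True: "vr s x \<noteq> 0 \<Longrightarrow> big c s t s' \<Longrightarrow> big (If x c d) s (Suc (Suc t)) s'"
| big_If_False: "vr s x = 0 \<Longrightarrow> big d s t s' \<Longrightarrow> big (If x c d) s (Suc t) s'"
| big_While_False: "vr s x = 0 \<Longrightarrow> big (While x c) s (Suc 0) s"
| big_While_True: "vr s x \<noteq> 0 \<Longrightarrow> big c s t s' \<Longrightarrow> big (While x c) s' t' s'' \<Longrightarrow>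
    big (While x c) s (Suc (Suc (t + t'))) s''"

inductive_cases big_AtomE: "big (Atom a) s t s'"

subsection \<open>Correctness of the compiler\<close>

text \<open>Registers 0 and 8 are invisible here, so compiled code may overwrite them
  freely.\<close>

definition abs_state :: "config \<Rightarrow> state" where
  "abs_state \<sigma> = \<lparr>vr = (\<lambda>x. reg \<sigma> (var_reg x)), ar = (\<lambda>a y. reg \<sigma> (arr_reg a y)),
     inq = inp \<sigma>, outq = outp \<sigma>\<rparr>"

definition code_at :: "program \<Rightarrow> nat \<Rightarrow> program \<Rightarrow> bool" where
  "code_at P p C \<longleftrightarrow> (\<exists>A D. P = A @ C @ D \<and> length A = p)"

text \<open>As simp rules, this and its companions for the empty list and Cons reduce the placement
  of compiled code to that of its parts.\<close>

lemma code_at_append [simp]: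
  "code_at P p (C @ D) \<longleftrightarrow> code_at P p C \<and> code_at P (p + length C) D"
proof
  assume "code_at P p C \<and> code_at P (p + length C) D"
  then obtain A1 D1 A2 D2 where P: "P = A1 @ C @ D1" "length A1 = p"
      "P = A2 @ D @ D2" "length A2 = p + length C"
    unfolding code_at_def by blast
  then have "A2 = A1 @ C" and "D1 = D @ D2"
    using append_eq_append_conv[of A2 "A1 @ C" "D @ D2" D1] by auto
  with P show "code_at P p (C @ D)"
    unfolding code_at_def by (intro exI[of _ A1] exI[of _ D2]) auto
next
  assume "code_at P p (C @ D)"
  then obtain A1 D1 where P: "P = A1 @ (C @ D) @ D1" "length A1 = p"
    unfolding code_at_def by auto
  then have "P = A1 @ C @ (D @ D1)" "P = (A1 @ C) @ D @ D1" "length (A1 @ C) = p + length C"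
    by auto
  with P(2) show "code_at P p C \<and> code_at P (p + length C) D"
    unfolding code_at_def by blast
qed

lemma code_at_Nil [simp]: "code_at P p [] \<longleftrightarrow> p \<le> length P"
proof
  assume "p \<le> length P"
  then show "code_at P p []"
    unfolding code_at_def by (intro exI[of _ "take p P"] exI[of _ "drop p P"]) simp
qed (auto simp: code_at_def)

definition instr_at :: "program \<Rightarrow> nat \<Rightarrow> instr \<Rightarrow> bool" where
  "instr_at P p i \<longleftrightarrow> p < length P \<and> P ! p = i"

lemma code_at_Cons [simp]: "code_at P p (i # D) \<longleftrightarrow> instr_at P p i \<and> code_at P (Suc p) D"
proof -
  have "code_at P p [i] \<longleftrightarrow> instr_at P p i"
  proof
    assume "instr_at P p i"
    then show "code_at P p [i]"
      unfolding code_at_def instr_at_def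
      by (intro exI[of _ "take p P"] exI[of _ "drop (Suc p) P"]) (auto simp: id_take_nth_drop)
  qed (auto simp: code_at_def instr_at_def)
  then show ?thesis
    using code_at_append[of P p "[i]" D] by simp
qed

lemma step_instr_at: "instr_at P (pc \<sigma>) i \<Longrightarrow> step P \<sigma> = exec_instr i \<sigma>"
  by (auto simp: instr_at_def step_def halted_def)

definition straight :: "instr \<Rightarrow> bool" where
  "straight i \<longleftrightarrow> (\<forall>\<sigma>. pc (exec_instr i \<sigma>) = Suc (pc \<sigma>))"

lemma steps_straight:
  assumes "code_at P (pc \<sigma>) C" and "\<forall>i\<in>set C. straight i"
  shows "(step P ^^ length C) \<sigma> = fold exec_instr C \<sigma>"
  using assms
proof (induction C arbitrary: \<sigma>)
  case (Cons i C)
  from Cons.prems have "step P \<sigma> = exec_instr i \<sigma>"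
    by (simp add: step_instr_at)
  moreover have "(step P ^^ length C) (exec_instr i \<sigma>) = fold exec_instr C (exec_instr i \<sigma>)"
    using Cons.prems by (intro Cons.IH) (auto simp: straight_def)
  ultimately show ?case
    by (simp add: funpow_Suc_right del: funpow.simps)
qed simp

lemma straight_atom_code: "i \<in> set (atom_code a) \<Longrightarrow> straight i"
  by (cases a) (auto simp: straight_def address_code_def)

lemma pc_fold_straight:
  "\<forall>i\<in>set C. straight i \<Longrightarrow> pc (fold exec_instr C \<sigma>) = pc \<sigma> + length C"
  by (induction C arbitrary: \<sigma>) (auto simp: straight_def)

lemma arr_index_bounds: "0 < arr_index a" "arr_index a < 7"
  by (cases a, simp_all)+

lemma arr_reg_div_mod: "arr_reg a y div 8 = y" "arr_reg a y mod 8 = arr_index a"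
  using arr_index_bounds(2)[of a] by (simp_all add: arr_reg_def)

lemma var_reg_div_mod: "var_reg x div 8 = var_index x" "var_reg x mod 8 = 7"
  unfolding var_reg_def by simp_all

lemma arr_index_eq: "arr_index a = arr_index b \<longleftrightarrow> a = b"
  by (cases a; cases b; simp)

lemma var_index_eq: "var_index x = var_index y \<longleftrightarrow> x = y"
  by (cases x; cases y; simp)

lemma var_reg_eq [simp]: "var_reg x = var_reg y \<longleftrightarrow> x = y"
  using var_index_eq by (metis var_reg_div_mod(1))

lemma var_reg_neq [simp]: "var_reg x \<noteq> 0" "var_reg x \<noteq> 8" "0 \<noteq> var_reg x" "8 \<noteq> var_reg x"
  using var_reg_div_mod(2)[of x] by fastforce+

lemma arr_reg_neq [simp]: "arr_reg a y \<noteq> 0" "arr_reg a y \<noteq> 8" "0 \<noteq> arr_reg a y" "8 \<noteq> arr_reg a y"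
  using arr_reg_div_mod(2)[of a y] arr_index_bounds(1)[of a] by fastforce+

lemma arr_reg_eq [simp]: "arr_reg a y = arr_reg b z \<longleftrightarrow> a = b \<and> y = z"
  using arr_index_eq by (metis arr_reg_div_mod)

lemma arr_reg_neq_var_reg [simp]: "arr_reg a y \<noteq> var_reg x" "var_reg x \<noteq> arr_reg a y"
  using arr_reg_div_mod(2)[of a y] var_reg_div_mod(2)[of x] arr_index_bounds(2)[of a] by auto

lemma abs_state_fold_atom_code:
  "abs_state (fold exec_instr (atom_code a) \<sigma>) = atom_exec a (abs_state \<sigma>)"
proof -
  \<comment> \<open>The value that the doublings in \<open>address_code\<close> leave in register
    0.\<close>
  have address: "k + k + (k + k) + (k + k + (k + k)) + arr_index b = arr_reg b k" for b k
    by (simp add: arr_reg_def)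
  show ?thesis
    by (cases a) (auto simp: abs_state_def address_code_def address fun_eq_iff)
qed

lemma funpow_add_apply: "(f ^^ (t + t')) x = (f ^^ t') ((f ^^ t) x)"
  by (metis add.commute comp_apply funpow_add)

lemma funpow_1_apply: "(f ^^ 1) x = f x" for f :: "'a \<Rightarrow> 'a"
  by simp

text \<open>Jump targets are absolute and subcommands are compiled at shifted positions, so the
  induction has to keep the start position arbitrary.\<close>

lemma compile_correct:
  assumes "big c s t s'" and "code_at P p (compile p c)" and "pc \<sigma> = p" and "abs_state \<sigma> = s"
  shows "\<exists>\<sigma>'. (step P ^^ t) \<sigma> = \<sigma>' \<and> abs_state \<sigma>' = s' \<and> pc \<sigma>' = p + length (compile p c)"
  using assms
proof (induction arbitrary: p \<sigma> rule: big.induct)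
  case (big_Atom a s)
  then show ?case
    by (auto simp: steps_straight straight_atom_code abs_state_fold_atom_code pc_fold_straight)
next
  case (big_Seq c s t s' d t' s'')
  from big_Seq.prems obtain \<sigma>1 where 1: "(step P ^^ t) \<sigma> = \<sigma>1" "abs_state \<sigma>1 = s'"
      "pc \<sigma>1 = p + length (compile p c)"
    using big_Seq.IH(1)[of p \<sigma>] by (auto simp: Let_def)
  with big_Seq.prems obtain \<sigma>2 where 2: "(step P ^^ t') \<sigma>1 = \<sigma>2" "abs_state \<sigma>2 = s''"
      "pc \<sigma>2 = pc \<sigma>1 + length (compile (pc \<sigma>1) d)"
    using big_Seq.IH(2)[of "pc \<sigma>1" \<sigma>1] by (auto simp: Let_def)
  have "(step P ^^ (t + t')) \<sigma> = \<sigma>2"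
    using 1(1) 2(1) by (simp only: funpow_add_apply)
  moreover have "pc \<sigma>2 = p + length (compile p (c ;; d))"
    using 1(3) 2(3) by (simp add: Let_def)
  ultimately show ?case using 2(2) by blast
next
  case (big_If_True s x c t s' d)
  let ?C = "compile (p + 1) c"
  have "reg \<sigma> (var_reg x) \<noteq> 0"
    using big_If_True.hyps(1) big_If_True.prems(3) by (auto simp: abs_state_def)
  with big_If_True.prems have 1: "step P \<sigma> = \<sigma>\<lparr>pc := p + 1\<rparr>"
    by (auto simp: Let_def step_instr_at)
  from big_If_True.prems obtain \<sigma>2 where 2: "(step P ^^ t) (\<sigma>\<lparr>pc := p + 1\<rparr>) = \<sigma>2"
      "abs_state \<sigma>2 = s'" "pc \<sigma>2 = p + 1 + length ?C"
    using big_If_True.IH[of "p + 1" "\<sigma>\<lparr>pc := p + 1\<rparr>"]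
    by (auto simp: Let_def abs_state_def)
  let ?q = "p + length ?C + 2"
  from 2(3) big_If_True.prems have "instr_at P (pc \<sigma>2) (Jump (?q + length (compile ?q d)))"
    by (simp add: Let_def)
  then have 3: "step P \<sigma>2 = \<sigma>2\<lparr>pc := ?q + length (compile ?q d)\<rparr>"
    by (simp add: step_instr_at)
  \<comment> \<open>One step for the test, \<open>t\<close> for the branch, one for the jump over
    the other branch.\<close>
  have "(step P ^^ (1 + (t + 1))) \<sigma> = \<sigma>2\<lparr>pc := ?q + length (compile ?q d)\<rparr>"
    unfolding funpow_add_apply funpow_1_apply 1 2(1) 3 ..
  then have "(step P ^^ Suc (Suc t)) \<sigma> = \<sigma>2\<lparr>pc := ?q + length (compile ?q d)\<rparr>"
    by (simp only: add_Suc_right One_nat_def add_0 add_Suc add_0_right)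
  moreover have "abs_state (\<sigma>2\<lparr>pc := ?q + length (compile ?q d)\<rparr>) = s'"
    using 2(2) by (simp add: abs_state_def)
  ultimately show ?case
    by (simp add: Let_def)
next
  case (big_If_False s x d t s' c)
  let ?q = "p + length (compile (p + 1) c) + 2"
  have "reg \<sigma> (var_reg x) = 0"
    using big_If_False.hyps(1) big_If_False.prems(3) by (auto simp: abs_state_def)
  with big_If_False.prems have 1: "step P \<sigma> = \<sigma>\<lparr>pc := ?q\<rparr>"
    by (auto simp: Let_def step_instr_at)
  from big_If_False.prems obtain \<sigma>2 where 2: "(step P ^^ t) (\<sigma>\<lparr>pc := ?q\<rparr>) = \<sigma>2"
      "abs_state \<sigma>2 = s'" "pc \<sigma>2 = ?q + length (compile ?q d)"
    using big_If_False.IH[of ?q "\<sigma>\<lparr>pc := ?q\<rparr>"]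
    by (auto simp: Let_def abs_state_def)
  have "(step P ^^ (1 + t)) \<sigma> = \<sigma>2"
    unfolding funpow_add_apply funpow_1_apply 1 2(1) ..
  then have "(step P ^^ Suc t) \<sigma> = \<sigma>2"
    by (simp only: One_nat_def add_0 add_Suc)
  then show ?case
    using 2(2,3) by (simp add: Let_def)
next
  case (big_While_False s x c)
  have "reg \<sigma> (var_reg x) = 0"
    using big_While_False.hyps(1) big_While_False.prems(3) by (auto simp: abs_state_def)
  with big_While_False.prems have "step P \<sigma> = \<sigma>\<lparr>pc := p + length (compile (p + 1) c) + 2\<rparr>"
    by (auto simp: Let_def step_instr_at)
  with big_While_False.prems show ?case
    by (auto simp: Let_def abs_state_def)
next
  case (big_While_True s x c t s' t' s'')
  let ?C = "compile (p + 1) c"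
  have "reg \<sigma> (var_reg x) \<noteq> 0"
    using big_While_True.hyps(1) big_While_True.prems(3) by (auto simp: abs_state_def)
  with big_While_True.prems have 1: "step P \<sigma> = \<sigma>\<lparr>pc := p + 1\<rparr>"
    by (auto simp: Let_def step_instr_at)
  from big_While_True.prems obtain \<sigma>2 where 2: "(step P ^^ t) (\<sigma>\<lparr>pc := p + 1\<rparr>) = \<sigma>2"
      "abs_state \<sigma>2 = s'" "pc \<sigma>2 = p + 1 + length ?C"
    using big_While_True.IH(1)[of "p + 1" "\<sigma>\<lparr>pc := p + 1\<rparr>"]
    by (auto simp: Let_def abs_state_def)
  from 2(3) big_While_True.prems have "instr_at P (pc \<sigma>2) (Jump p)"
    by (simp add: Let_def)
  then have 3: "step P \<sigma>2 = \<sigma>2\<lparr>pc := p\<rparr>"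
    by (simp add: step_instr_at)
  from 2(2) big_While_True.prems obtain \<sigma>3 where 4: "(step P ^^ t') (\<sigma>2\<lparr>pc := p\<rparr>) = \<sigma>3"
      "abs_state \<sigma>3 = s''" "pc \<sigma>3 = p + length (compile p (While x c))"
    using big_While_True.IH(2)[of p "\<sigma>2\<lparr>pc := p\<rparr>"] by (auto simp: abs_state_def)
  have "(step P ^^ (1 + (t + (1 + t')))) \<sigma> = \<sigma>3"
    unfolding funpow_add_apply funpow_1_apply 1 2(1) 3 4(1) ..
  moreover have "1 + (t + (1 + t')) = Suc (Suc (t + t'))"
    by simp
  ultimately show ?case
    using 4(2,3) by metis
qed

definition init_state :: "nat list \<Rightarrow> state" where
  "init_state xs = \<lparr>vr = (\<lambda>_. 0), ar = (\<lambda>_ _. 0), inq = xs, outq = []\<rparr>"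

lemma big_computes_within:
  assumes "big c (init_state xs) t s"
  shows "computes_within (compile 0 c) xs (outq s) t"
proof -
  have "abs_state (init_config xs) = init_state xs"
    by (simp add: abs_state_def init_config_def init_state_def)
  moreover have "code_at (compile 0 c) 0 (compile 0 c)"
    by (simp add: code_at_def)
  moreover have "pc (init_config xs) = 0"
    by (simp add: init_config_def)
  ultimately obtain \<sigma> where "(step (compile 0 c) ^^ t) (init_config xs) = \<sigma>"
      "abs_state \<sigma> = s" "pc \<sigma> = length (compile 0 c)"
    using compile_correct[OF assms] by fastforce
  then show ?thesis
    by (auto simp: computes_within_def Let_def halted_def abs_state_def)
qed

subsection \<open>Time bounds and program logic\<close>

text \<open>The polynomial bounds the time in terms of a common bound for the numbers of
  iterations of all loops.\<close>

primrec time_poly :: "com \<Rightarrow> nat poly" where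
  "time_poly (Atom a) = [:length (atom_code a):]"
| "time_poly (c ;; d) = time_poly c + time_poly d"
| "time_poly (If x c d) = time_poly c + time_poly d + 2"
| "time_poly (While x c) = [:0, 1:] * (time_poly c + 2) + 1"

text \<open>Total correctness together with a time bound. As \<open>Z\<close> is fixed for a whole
  run, the bounds of successive commands add up.\<close>

definition runs :: "nat \<Rightarrow> com \<Rightarrow> state \<Rightarrow> (state \<Rightarrow> bool) \<Rightarrow> bool" where
  "runs Z c s Q \<longleftrightarrow> (\<exists>t s'. big c s t s' \<and> t \<le> poly (time_poly c) Z \<and> Q s')"

lemma runs_Atom [simp]: "runs Z (Atom a) s Q \<longleftrightarrow> Q (atom_exec a s)"
  by (auto simp: runs_def intro: big_Atom elim: big_AtomE)

lemma runs_conseq: "runs Z c s R \<Longrightarrow> (\<And>s'. R s' \<Longrightarrow> Q s') \<Longrightarrow> runs Z c s Q"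
  unfolding runs_def by blast

lemma runs_Seq:
  assumes "runs Z c s (\<lambda>s'. runs Z d s' Q)"
  shows "runs Z (c ;; d) s Q"
proof -
  from assms obtain t s' t' s'' where "big c s t s'" "t \<le> poly (time_poly c) Z"
      "big d s' t' s''" "t' \<le> poly (time_poly d) Z" "Q s''"
    unfolding runs_def by blast
  then show ?thesis
    unfolding runs_def by (intro exI[of _ "t + t'"] exI[of _ s'']) (auto intro: big_Seq)
qed

lemma runs_Atom_Seq: "runs Z d (atom_exec a s) Q \<Longrightarrow> runs Z (Atom a ;; d) s Q"
  by (rule runs_Seq) simp

lemma runs_If:
  assumes "vr s x \<noteq> 0 \<Longrightarrow> runs Z c s Q" and "vr s x = 0 \<Longrightarrow> runs Z d s Q"
  shows "runs Z (If x c d) s Q"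
proof (cases "vr s x = 0")
  case True
  with assms(2) obtain t s' where "big d s t s'" "t \<le> poly (time_poly d) Z" "Q s'"
    unfolding runs_def by blast
  with True show ?thesis
    unfolding runs_def by (intro exI[of _ "t + 1"] exI[of _ s']) (auto intro: big_If_False)
next
  case False
  with assms(1) obtain t s' where "big c s t s'" "t \<le> poly (time_poly c) Z" "Q s'"
    unfolding runs_def by blast
  with False show ?thesis
    unfolding runs_def by (intro exI[of _ "t + 2"] exI[of _ s']) (auto intro: big_If_True)
qed

section \<open>Frame conditions\<close>

primrec atom_vars :: "atom \<Rightarrow> var set" where
  "atom_vars (SetC x k) = {x}" | "atom_vars (SetV x y) = {x}" | "atom_vars (Inc x) = {x}"
| "atom_vars (Dec x) = {x}" | "atom_vars (AddV x y z) = {x}" | "atom_vars (SubV x y z) = {x}"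
| "atom_vars (Get x a y) = {x}" | "atom_vars (Put a y x) = {}" | "atom_vars (Rd x) = {x}"
| "atom_vars (Wr x) = {}"

primrec atoms :: "com \<Rightarrow> atom set" where
  "atoms (Atom a) = {a}"
| "atoms (c ;; d) = atoms c \<union> atoms d"
| "atoms (If x c d) = atoms c \<union> atoms d"
| "atoms (While x c) = atoms c"

text \<open>What a command leaves alone can be read off its atoms, so loop invariants need to
  mention only what changes.\<close>

definition frame :: "com \<Rightarrow> state \<Rightarrow> state \<Rightarrow> bool" where
  "frame c s s' \<longleftrightarrow> (\<forall>x. (\<forall>a\<in>atoms c. x \<notin> atom_vars a) \<longrightarrow> vr s' x = vr s x) \<and>
     (\<forall>b. (\<forall>a\<in>atoms c. \<forall>y x. a \<noteq> Put b y x) \<longrightarrow> ar s' b = ar s b) \<and>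
     ((\<forall>a\<in>atoms c. \<forall>x. a \<noteq> Rd x) \<longrightarrow> inq s' = inq s) \<and>
     ((\<forall>a\<in>atoms c. \<forall>x. a \<noteq> Wr x) \<longrightarrow> outq s' = outq s)"

lemma big_frame: "big c s t s' \<Longrightarrow> frame c s s'"
proof (induction rule: big.induct)
  case (big_Atom a s)
  then show ?case by (cases a) (auto simp: frame_def)
next
  case (big_Seq c s t s' d t' s'')
  then show ?case unfolding frame_def by simp
next
  case (big_While_True s x c t s' t' s'')
  then show ?case unfolding frame_def by simp
qed (simp_all add: frame_def)

lemma runs_frame:
  assumes "runs Z c s R" and "\<And>s'. R s' \<Longrightarrow> frame c s s' \<Longrightarrow> Q s'"
  shows "runs Z c s Q"
  using assms big_frame unfolding runs_def by blast

text \<open>The measure \<open>f\<close> bounds the remaining rounds. Each costs the body plus two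
  steps for test and back jump; the final test costs one more. The frame refers to the fixed state
  \<open>s0\<close>, so the body may rely on everything that the loop never assigns.\<close>

lemma runs_While_aux:
  assumes body: "\<And>s'. I s' \<Longrightarrow> frame c s0 s' \<Longrightarrow> vr s' x \<noteq> 0 \<Longrightarrow>
      runs Z c s' (\<lambda>s''. I s'' \<and> f s'' < f s')"
    and "I s" and "frame c s0 s"
  shows "\<exists>t s'. big (While x c) s t s' \<and> t \<le> f s * (poly (time_poly c) Z + 2) + 1 \<and>
      I s' \<and> frame c s0 s' \<and> vr s' x = 0"
  using assms(2,3)
proof (induction "f s" arbitrary: s rule: less_induct)
  case less
  show ?case
  proof (cases "vr s x = 0")
    case True
    with less.prems show ?thesis
      by (intro exI[of _ 1] exI[of _ s]) (auto intro: big_While_False)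
  next
    case False
    with body less.prems obtain t s1 where 1: "big c s t s1" "t \<le> poly (time_poly c) Z"
        "I s1" "f s1 < f s"
      unfolding runs_def by blast
    have "frame c s0 s1"
      using less.prems(2) big_frame[OF 1(1)] unfolding frame_def by simp
    with less.hyps[OF 1(4,3)] obtain t' s2 where 2: "big (While x c) s1 t' s2"
        "t' \<le> f s1 * (poly (time_poly c) Z + 2) + 1" "I s2" "frame c s0 s2" "vr s2 x = 0"
      by blast
    have "t + t' + 2 \<le> Suc (f s1) * (poly (time_poly c) Z + 2) + 1"
      using 1(2) 2(2) by simp
    also have "\<dots> \<le> f s * (poly (time_poly c) Z + 2) + 1"
      using 1(4) by (intro add_right_mono mult_right_mono) auto
    finally show ?thesis
      using big_While_True[OF False 1(1) 2(1)] 2 by (metis add_2_eq_Suc')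
  qed
qed

lemma runs_While:
  assumes "I s"
    and "\<And>s'. I s' \<Longrightarrow> frame c s s' \<Longrightarrow> vr s' x \<noteq> 0 \<Longrightarrow>
      runs Z c s' (\<lambda>s''. I s'' \<and> f s'' < f s')"
    and "f s \<le> Z"
    and "\<And>s'. I s' \<Longrightarrow> frame c s s' \<Longrightarrow> vr s' x = 0 \<Longrightarrow> Q s'"
  shows "runs Z (While x c) s Q"
proof -
  have "frame c s s" by (simp add: frame_def)
  with runs_While_aux[of I c s x Z f s] assms obtain t s' where
    *: "big (While x c) s t s'" "t \<le> f s * (poly (time_poly c) Z + 2) + 1" "Q s'"
    by blast
  have "f s * (poly (time_poly c) Z + 2) \<le> Z * (poly (time_poly c) Z + 2)"
    using assms(3) by (rule mult_right_mono) simp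
  with * show ?thesis
    unfolding runs_def by (intro exI[of _ t] exI[of _ s']) auto
qed

section \<open>Encoding utility vectors as numbers\<close>

lemma digits_less:
  fixes d :: "nat \<Rightarrow> nat"
  assumes "\<And>j. j < k \<Longrightarrow> d j < B"
  shows "(\<Sum>j<k. d j * B ^ j) < B ^ k"
  using assms
proof (induction k)
  case (Suc k)
  have "(\<Sum>j<Suc k. d j * B ^ j) < B ^ k + d k * B ^ k"
    using Suc by simp
  also have "\<dots> = Suc (d k) * B ^ k"
    by simp
  also have "\<dots> \<le> B * B ^ k"
    using Suc.prems[of k] by (intro mult_right_mono) auto
  finally show ?case by simp
qed simp

lemma digits_mod:
  fixes d :: "nat \<Rightarrow> nat"
  assumes "\<And>j. j < n \<Longrightarrow> d j < B" and "k \<le> n"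
  shows "(\<Sum>j<n. d j * B ^ j) mod B ^ k = (\<Sum>j<k. d j * B ^ j)"
proof -
  have "(\<Sum>j<n. d j * B ^ j) = (\<Sum>j<k. d j * B ^ j) + (\<Sum>j\<in>{k..<n}. d j * B ^ j)"
    using assms(2) by (simp add: sum.atLeastLessThan_concat atLeast0LessThan[symmetric])
  moreover have "B ^ k dvd (\<Sum>j\<in>{k..<n}. d j * B ^ j)"
    by (intro dvd_sum dvd_mult le_imp_power_dvd) simp
  moreover have "(\<Sum>j<k. d j * B ^ j) < B ^ k"
    using assms by (intro digits_less) simp
  ultimately show ?thesis
    by auto
qed

text \<open>The digits below \<open>i\<close> contribute less than \<open>B ^ i\<close> and cannot
  make up for a missing unit of digit \<open>i\<close>. So a digit can be compared with a scaled
  threshold without being extracted.\<close>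

lemma digit_ge_iff:
  fixes d :: "nat \<Rightarrow> nat"
  assumes "\<And>j. j < n \<Longrightarrow> d j < B" and "i < n"
  shows "r * B ^ i \<le> (\<Sum>j<n. d j * B ^ j) mod B ^ Suc i \<longleftrightarrow> r \<le> d i"
proof -
  let ?q = "\<Sum>j<i. d j * B ^ j"
  have q: "?q < B ^ i"
    using assms by (intro digits_less) simp
  have eq: "(\<Sum>j<n. d j * B ^ j) mod B ^ Suc i = ?q + d i * B ^ i"
    using digits_mod[OF assms(1), where k = "Suc i"] assms(2) by simp
  have "r \<le> d i" if "r * B ^ i \<le> ?q + d i * B ^ i"
  proof -
    have "r * B ^ i < Suc (d i) * B ^ i"
      using that q by simp
    then have "r < Suc (d i)"
      by (simp only: mult_less_cancel2)
    then show ?thesis by simp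
  qed
  moreover have "r * B ^ i \<le> ?q + d i * B ^ i" if "r \<le> d i"
    using that by (simp add: trans_le_add2)
  ultimately show ?thesis
    unfolding eq by blast
qed

text \<open>In this locale agents and objects are numbered from 0. A list \<open>l\<close> of at most \<open>m\<close> agents stands
  for an assignment of the last \<open>length l\<close> objects; the base \<open>B\<close> exceeds all utilities of
  bundles, so that \<open>code l\<close> determines the utilities of all agents.\<close>

locale coded_instance =
  fixes n m B :: nat and U :: "nat \<Rightarrow> nat \<Rightarrow> nat" and own :: "nat \<Rightarrow> nat"
  assumes sum_U_less: "i < n \<Longrightarrow> (\<Sum>x<m. U i x) < B"
    and own_less: "x < m \<Longrightarrow> own x < n"
    and B_pos: "0 < B"
begin

definition K :: nat where
  "K = B ^ n"

definition wt :: "nat \<Rightarrow> nat \<Rightarrow> nat" where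
  "wt i x = U i x * B ^ i"

text \<open>Lists grow at the head, from object \<open>m - 1\<close> backwards.\<close>

primrec util :: "nat list \<Rightarrow> nat \<Rightarrow> nat" where
  "util [] j = 0"
| "util (i # l) j = (if i = j then U i (m - Suc (length l)) else 0) + util l j"

definition code :: "nat list \<Rightarrow> nat" where
  "code l = (\<Sum>j<n. util l j * B ^ j)"

text \<open>The index of column \<open>code l\<close> in row \<open>length l\<close> of a table of
  width \<open>K\<close>, written as the increments that the program performs.\<close>

primrec pos :: "nat list \<Rightarrow> nat" where
  "pos [] = 0"
| "pos (i # l) = K + wt i (m - Suc (length l)) + pos l"

definition valid :: "nat list \<Rightarrow> bool" where
  "valid l \<longleftrightarrow> set l \<subseteq> {..<n} \<and> length l \<le> m"

lemma K_pos: "0 < K"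
  using B_pos by (simp add: K_def)

lemma valid_Cons [simp]: "valid (i # l) \<longleftrightarrow> i < n \<and> length l < m \<and> valid l"
  by (auto simp: valid_def)

lemma valid_Nil [simp]: "valid []"
  by (simp add: valid_def)

lemma util_eq:
  "length l \<le> m \<Longrightarrow> util l j =
    (\<Sum>x\<in>{m - length l..<m}. if l ! (x - (m - length l)) = j then U j x else 0)"
proof (induction l)
  case (Cons i l)
  let ?a = "m - Suc (length l)"
  have a: "m - length l = Suc ?a" "?a < m"
    using Cons.prems by auto
  have "(\<Sum>x\<in>{?a..<m}. if (i # l) ! (x - ?a) = j then U j x else 0) =
      (if i = j then U j ?a else 0) +
      (\<Sum>x\<in>{Suc ?a..<m}. if (i # l) ! (x - ?a) = j then U j x else 0)"
    using a(2) by (simp add: sum.atLeast_Suc_lessThan)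
  also have "(\<Sum>x\<in>{Suc ?a..<m}. if (i # l) ! (x - ?a) = j then U j x else 0) =
      (\<Sum>x\<in>{m - length l..<m}. if l ! (x - (m - length l)) = j then U j x else 0)"
    unfolding a(1) by (intro sum.cong) (auto simp: nth_Cons')
  finally show ?case
    using Cons by simp
qed simp

lemma util_less:
  assumes "valid l" and "j < n"
  shows "util l j < B"
proof -
  have "util l j \<le> (\<Sum>x\<in>{m - length l..<m}. U j x)"
    using assms by (subst util_eq) (auto simp: valid_def intro!: sum_mono)
  also have "\<dots> \<le> (\<Sum>x<m. U j x)"
    by (intro sum_mono2) auto
  also have "\<dots> < B"
    using assms(2) by (rule sum_U_less)
  finally show ?thesis .
qed

lemma code_Cons:
  assumes "i < n"
  shows "code (i # l) = wt i (m - Suc (length l)) + code l"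
proof -
  have "code (i # l) = (\<Sum>j<n. if i = j then U i (m - Suc (length l)) * B ^ j else 0) + code l"
    unfolding code_def sum.distrib[symmetric]
    by (rule sum.cong) (simp_all add: distrib_right)
  also have "(\<Sum>j<n. if i = j then U i (m - Suc (length l)) * B ^ j else 0) =
      wt i (m - Suc (length l))"
    using assms by (simp add: wt_def)
  finally show ?thesis .
qed

lemma code_less: "valid l \<Longrightarrow> code l < K"
  unfolding code_def K_def by (intro digits_less util_less)

lemma pos_eq: "valid l \<Longrightarrow> pos l = length l * K + code l"
  by (induction l) (auto simp: code_Cons code_def[of "[]"])

lemma pos_div: "valid l \<Longrightarrow> pos l div K = length l"
  using code_less[of l] K_pos by (simp add: pos_eq)

section \<open>Dynamic programming\<close>

text \<open>The quotient \<open>p div K\<close> counts the objects already distributed and thereby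
  determines the next one.\<close>

definition target :: "nat \<Rightarrow> nat \<Rightarrow> nat" where
  "target p i = p + K + wt i (m - Suc (p div K))"

lemma target_pos: "valid (i # l) \<Longrightarrow> target (pos l) i = pos (i # l)"
  by (simp add: target_def pos_div)

text \<open>Moves lead strictly forward: one increasing scan meets each position after all its
  predecessors, and following back pointers terminates.\<close>

lemma target_gt: "p < target p i"
  using K_pos by (simp add: target_def)

text \<open>The table \<open>T\<close> marks the reachable positions, recording an agent that may receive the last
  assigned object, and \<open>X\<close> holds the corresponding preceding position.\<close>

definition edge :: "(nat \<Rightarrow> nat) \<Rightarrow> (nat \<Rightarrow> nat) \<Rightarrow> nat \<Rightarrow> bool" where
  "edge T X d \<longleftrightarrow> (\<exists>i<n. T d = Suc i \<and> T (X d) \<noteq> 0 \<and> X d div K < m \<and> d = target (X d) i)"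

text \<open>All positions below \<open>p\<close> have been processed, and at \<open>p\<close> the agents below \<open>j\<close>.\<close>

definition dp_inv :: "nat \<Rightarrow> nat \<Rightarrow> (nat \<Rightarrow> nat) \<Rightarrow> (nat \<Rightarrow> nat) \<Rightarrow> bool" where
  "dp_inv p j T X \<longleftrightarrow> T 0 \<noteq> 0 \<and> (\<forall>d. d \<noteq> 0 \<longrightarrow> T d \<noteq> 0 \<longrightarrow> edge T X d) \<and>
     (\<forall>q i. T q \<noteq> 0 \<longrightarrow> q div K < m \<longrightarrow> i < n \<longrightarrow> q < p \<or> q = p \<and> i < j \<longrightarrow> T (target q i) \<noteq> 0)"

lemma dp_inv_init: "T 0 \<noteq> 0 \<Longrightarrow> (\<And>d. d \<noteq> 0 \<Longrightarrow> T d = 0) \<Longrightarrow> dp_inv 0 0 T X"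
  by (simp add: dp_inv_def)

text \<open>An already marked target gets its entry overwritten. This is harmless: no mark is ever
  erased, both tables change together, and \<open>edge\<close> asks of the predecessor's table entry
  only that it be nonzero.\<close>

lemma dp_inv_step:
  assumes inv: "dp_inv p j T X" and p: "T p \<noteq> 0" "p div K < m" and j: "j < n"
  shows "dp_inv p (Suc j) (T(target p j := Suc j)) (X(target p j := p))"
proof -
  let ?t = "target p j"
  let ?T = "T(?t := Suc j)" and ?X = "X(?t := p)"
  have "edge ?T ?X d" if "d \<noteq> 0" "?T d \<noteq> 0" for d
  proof (cases "d = ?t")
    case True
    then show ?thesis
      using p j target_gt[of p j] unfolding edge_def by (intro exI[of _ j]) auto
  next
    case False
    then have "edge T X d"
      using that inv by (simp add: dp_inv_def)
    with False show ?thesis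
      unfolding edge_def by auto
  qed
  moreover have "?T (target q i) \<noteq> 0"
    if q: "?T q \<noteq> 0" "q div K < m" "i < n" "q < p \<or> q = p \<and> i < Suc j" for q i
  proof (cases "target q i = ?t")
    case False
    have "q \<noteq> ?t"
      using q(4) target_gt[of p j] by auto
    with False q show ?thesis
      using inv unfolding dp_inv_def by (auto simp: less_Suc_eq)
  qed simp
  ultimately show ?thesis
    using inv unfolding dp_inv_def by simp
qed

lemma dp_inv_Suc: "dp_inv p n T X \<Longrightarrow> dp_inv (Suc p) 0 T X"
  unfolding dp_inv_def by (auto simp: less_Suc_eq)

lemma dp_inv_Suc_unmarked: "dp_inv p 0 T X \<Longrightarrow> T p = 0 \<Longrightarrow> dp_inv (Suc p) 0 T X"
  unfolding dp_inv_def by (auto simp: less_Suc_eq)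

text \<open>The suffixes of \<open>l\<close> form a path from position 0 to \<open>pos l\<close>,
  and every move on it starts in a row before \<open>m\<close>, hence at a processed
  position.\<close>

lemma dp_complete:
  assumes "dp_inv (m * K) 0 T X" and "valid l"
  shows "T (pos l) \<noteq> 0"
  using assms(2)
proof (induction l)
  case Nil
  then show ?case using assms(1) by (simp add: dp_inv_def)
next
  case (Cons i l)
  then have "T (pos l) \<noteq> 0" "pos l div K < m" "i < n"
    by (auto simp: pos_div)
  moreover from this(2) have "pos l < m * K"
    using K_pos by (simp add: div_less_iff_less_mult)
  ultimately have "T (target (pos l) i) \<noteq> 0"
    using assms(1) by (simp add: dp_inv_def)
  then show ?case
    using target_pos[OF Cons.prems] by simp
qed

lemma dp_sound:
  assumes "dp_inv p j T X" and "T d \<noteq> 0"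
  shows "\<exists>l. valid l \<and> pos l = d"
  using assms(2)
proof (induction d rule: less_induct)
  case (less d)
  show ?case
  proof (cases "d = 0")
    case True
    then show ?thesis by (intro exI[of _ "[]"]) simp
  next
    case False
    with less.prems assms(1) have "edge T X d"
      by (simp add: dp_inv_def)
    then obtain i where i: "i < n" "T (X d) \<noteq> 0" "X d div K < m" "d = target (X d) i"
      unfolding edge_def by blast
    then have "X d < d"
      using target_gt[of "X d" i] by simp
    with less.IH i(2) obtain l where l: "valid l" "pos l = X d"
      by blast
    with i have "valid (i # l)"
      using pos_div[OF l(1)] by simp
    moreover from this have "pos (i # l) = d"
      using target_pos[of i l] i(4) l(2) by simp
    ultimately show ?thesis by blast
  qed
qed

text \<open>The subtraction undoes the shift by one that keeps 0 free for unmarked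
  positions.\<close>

primrec trace :: "(nat \<Rightarrow> nat) \<Rightarrow> (nat \<Rightarrow> nat) \<Rightarrow> nat \<Rightarrow> nat \<Rightarrow> nat list" where
  "trace T X 0 d = []"
| "trace T X (Suc k) d = (T d - 1) # trace T X k (X d)"

text \<open>Soundness shows that the predecessor lies exactly one row earlier: positions of valid
  lists have codes below \<open>K\<close>, so the added weight does not spill into a further
  row.\<close>

lemma dp_pred:
  assumes inv: "dp_inv p j T X" and "T d \<noteq> 0" and "d div K = Suc k"
  shows "\<exists>i<n. T d = Suc i \<and> T (X d) \<noteq> 0 \<and> X d div K = k \<and> k < m \<and> d = target (X d) i"
proof -
  have "d \<noteq> 0"
    using assms(3) by (cases "d = 0") auto
  with assms(1,2) have "edge T X d"
    by (simp add: dp_inv_def)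
  then obtain i where i: "i < n" "T d = Suc i" "T (X d) \<noteq> 0" "X d div K < m" "d = target (X d) i"
    unfolding edge_def by blast
  from dp_sound[OF inv i(3)] obtain l where l: "valid l" "pos l = X d"
    by blast
  with i have v: "valid (i # l)"
    using pos_div[OF l(1)] by simp
  have "Suc k = Suc (length l)"
    using pos_div[OF v] target_pos[OF v] i(5) l(2) assms(3) by simp
  then have "X d div K = k"
    using pos_div[OF l(1)] l(2) by simp
  with i show ?thesis by auto
qed

lemma dp_trace:
  assumes inv: "dp_inv p j T X" and "T d \<noteq> 0" and "d div K = k"
  shows "valid (trace T X k d) \<and> length (trace T X k d) = k \<and> pos (trace T X k d) = d"
  using assms(2,3)
proof (induction k arbitrary: d)
  case 0
  from dp_sound[OF inv 0(1)] obtain l where "valid l" "pos l = d" by blast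
  with 0(2) pos_div[of l] show ?case by auto
next
  case (Suc k)
  from dp_pred[OF inv Suc.prems] obtain i where i: "i < n" "T d = Suc i" "T (X d) \<noteq> 0"
      "X d div K = k" "k < m" "d = target (X d) i"
    by blast
  with Suc.IH[OF i(3,4)] show ?case
    using target_pos[of i "trace T X k (X d)"] by simp
qed

section \<open>Individual rationality and Pareto optimality\<close>

definition endowed :: "nat \<Rightarrow> nat" where
  "endowed i = (\<Sum>x<m. if own x = i then U i x else 0)"

text \<open>Phrased for plain numbers, because the search inspects columns of the table rather than
  lists.\<close>

definition good :: "nat \<Rightarrow> bool" where
  "good c \<longleftrightarrow> (\<forall>i<n. endowed i * B ^ i \<le> c mod B ^ Suc i)"

lemma good_code: "valid l \<Longrightarrow> good (code l) \<longleftrightarrow> (\<forall>i<n. endowed i \<le> util l i)"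
  unfolding good_def code_def using digit_ge_iff[of n "util l" B, OF util_less] by simp

lemma util_full: "length l = m \<Longrightarrow> util l j = (\<Sum>x<m. if l ! x = j then U j x else 0)"
  by (simp add: util_eq atLeast0LessThan)

definition best :: "nat list \<Rightarrow> bool" where
  "best l \<longleftrightarrow> valid l \<and> length l = m \<and> good (code l) \<and>
     (\<forall>l'. valid l' \<longrightarrow> length l' = m \<longrightarrow> good (code l') \<longrightarrow> code l' \<le> code l)"

text \<open>The code is a positively weighted sum of the utilities.\<close>

lemma best_undominated:
  assumes "best l" and "valid l'" and "length l' = m"
    and "\<And>i. i < n \<Longrightarrow> util l i \<le> util l' i" and "i < n"
  shows "util l' i \<le> util l i"
proof (rule ccontr)
  assume "\<not> util l' i \<le> util l i"
  then have "util l i * B ^ i < util l' i * B ^ i"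
    using B_pos by simp
  with assms(4,5) have "code l < code l'"
    unfolding code_def by (intro sum_strict_mono_ex1) auto
  moreover have "\<forall>i<n. endowed i \<le> util l i"
    using assms(1) good_code unfolding best_def by blast
  then have "good (code l')"
    using assms(2,4) good_code le_trans by blast
  ultimately show False
    using assms(1-3) unfolding best_def by auto
qed

text \<open>The endowment itself is the witness that the search has a candidate.\<close>

lemma endowment_good: "\<exists>l. valid l \<and> length l = m \<and> good (code l)"
proof (intro exI conjI)
  let ?l = "map own [0..<m]"
  show "valid ?l" "length ?l = m"
    using own_less by (auto simp: valid_def)
  then show "good (code ?l)"
    by (simp add: good_code util_full endowed_def)
qed

end

section \<open>The program\<close>

text \<open>\<open>vM\<close>, \<open>vB\<close> and \<open>vK\<close> hold \<open>m\<close>, \<open>B\<close> and \<open>B ^ n\<close>; \<open>vP\<close> is a table position and \<open>vC\<close> its code.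
  The array \<open>aW\<close> holds the input after \<open>m\<close>, whose utilities are later scaled to weights; \<open>aP\<close> the
  powers of \<open>B\<close>; \<open>aE\<close> the scaled utilities of the endowment; \<open>aT\<close> and \<open>aX\<close> the tables \<open>T\<close> and
  \<open>X\<close>.\<close>

declare [[coercion Atom]]

lemma frame_vr: "frame c s s' \<Longrightarrow> \<forall>a\<in>atoms c. x \<notin> atom_vars a \<Longrightarrow> vr s' x = vr s x"
  and frame_ar: "frame c s s' \<Longrightarrow> \<forall>a\<in>atoms c. \<forall>y x. a \<noteq> Put b y x \<Longrightarrow> ar s' b = ar s b"
  and frame_inq: "frame c s s' \<Longrightarrow> \<forall>a\<in>atoms c. \<forall>x. a \<noteq> Rd x \<Longrightarrow> inq s' = inq s"
  and frame_outq: "frame c s s' \<Longrightarrow> \<forall>a\<in>atoms c. \<forall>x. a \<noteq> Wr x \<Longrightarrow> outq s' = outq s"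
  unfolding frame_def by blast+

lemmas frame_rules = frame_vr frame_ar frame_inq frame_outq

section \<open>Multiplication, input and weights\<close>

definition add_rows :: com where
  "add_rows = While vX (AddV vY vY vM ;; Dec vX)"

text \<open>Only the factor in \<open>vX\<close> is counted down, so only this factor has to be
  bounded by \<open>Z\<close>.\<close>

definition mult :: com where
  "mult = SetC vY 0 ;; While vX (AddV vY vY vK ;; Dec vX)"

lemma atoms_add_rows [simp]: "atoms add_rows = {AddV vY vY vM, Dec vX}"
  by (auto simp: add_rows_def)

lemma atoms_mult [simp]: "atoms mult = {SetC vY 0, AddV vY vY vK, Dec vX}"
  by (auto simp: mult_def)

lemma runs_add_rows:
  assumes "vr s vX \<le> Z"
  shows "runs Z add_rows s (\<lambda>s'. vr s' vY = vr s vY + vr s vX * vr s vM)"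
  unfolding add_rows_def
proof (rule runs_While[where f = "\<lambda>s. vr s vX" and
      I = "\<lambda>s'. vr s' vY + vr s' vX * vr s vM = vr s vY + vr s vX * vr s vM"], goal_cases)
  case (2 s')
  note fr = frame_rules[OF 2(2)]
  from 2(3) obtain k where "vr s' vX = Suc k"
    by (cases "vr s' vX") auto
  with 2(1) show ?case
    by (intro runs_Atom_Seq) (simp add: fr)
qed (use assms in simp_all)

lemma runs_mult:
  assumes "vr s vX \<le> Z"
  shows "runs Z mult s (\<lambda>s'. vr s' vY = vr s vX * vr s vK)"
  unfolding mult_def
proof (rule runs_Atom_Seq, rule runs_While[where f = "\<lambda>s. vr s vX" and
      I = "\<lambda>s'. vr s' vY + vr s' vX * vr s vK = vr s vX * vr s vK"], goal_cases)
  case (2 s')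
  note fr = frame_rules[OF 2(2)]
  from 2(3) obtain k where "vr s' vX = Suc k"
    by (cases "vr s' vX") auto
  with 2(1) show ?case
    by (intro runs_Atom_Seq) (simp add: fr)
qed (use assms in simp_all)

text \<open>There are \<open>n + 1\<close> rows of \<open>m\<close> numbers: one row of utilities
  per agent, then the owners. Starting \<open>vB\<close> at 1 makes the base exceed the sum of them
  all.\<close>

definition read_input :: "nat \<Rightarrow> com" where
  "read_input n =
    Rd vM ;; SetC vL 0 ;; SetC vR (Suc n) ;;
    While vR (AddV vL vL vM ;; Dec vR) ;;
    SetC vB 1 ;; SetC vQ 0 ;;
    While vL (Rd vX ;; Put aW vQ vX ;; Inc vQ ;; AddV vB vB vX ;; Dec vL)"

lemma runs_read_input:
  assumes "length ys = Suc n * m" and "Suc n \<le> Z" and "length ys \<le> Z" and "inq s = m # ys"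
  shows "runs Z (read_input n) s (\<lambda>s'. vr s' vM = m \<and> vr s' vB = Suc (sum_list ys) \<and>
    (\<forall>q<length ys. ar s' aW q = ys ! q))"
  unfolding read_input_def
proof (intro runs_Atom_Seq, rule runs_Seq, rule runs_While[where f = "\<lambda>s. vr s vR" and
      I = "\<lambda>s. vr s vL + vr s vR * m = Suc n * m"], goal_cases)
  case (2 s1)
  note fr = frame_rules[OF 2(2)]
  from 2(3) obtain k where "vr s1 vR = Suc k"
    by (cases "vr s1 vR") auto
  with 2(1) show ?case
    by (intro runs_Atom_Seq) (simp add: fr assms)
next
  case (4 s1)
  note fr = frame_rules[OF 4(2)]
  show ?case
  proof (intro runs_Atom_Seq, rule runs_While[where f = "\<lambda>s. vr s vL" and
      I = "\<lambda>s. vr s vQ + vr s vL = length ys \<and> inq s = drop (vr s vQ) ys \<and>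
         vr s vB = Suc (sum_list (take (vr s vQ) ys)) \<and> (\<forall>q<vr s vQ. ar s aW q = ys ! q)"],
      goal_cases)
    case 1
    show ?case using 4 by (simp add: fr assms)
  next
    case (2 s2)
    then have "vr s2 vQ < length ys" by simp
    then have "drop (vr s2 vQ) ys = ys ! vr s2 vQ # drop (Suc (vr s2 vQ)) ys"
      "take (Suc (vr s2 vQ)) ys = take (vr s2 vQ) ys @ [ys ! vr s2 vQ]"
      by (simp_all add: Cons_nth_drop_Suc take_Suc_conv_app_nth)
    with 2 show ?case
      by (intro runs_Atom_Seq) (auto simp: less_Suc_eq)
  next
    case 3
    show ?case using 4 assms by (simp add: fr)
  next
    case (4 s2)
    note fr2 = frame_rules[OF 4(2)]
    from 4 show ?case by (simp add: fr fr2 assms)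
  qed
qed (use assms in simp_all)

definition weight_row :: com where
  "weight_row = While vJ (Get vX aW vQ ;; mult ;; Put aW vQ vY ;; Inc vQ ;; Dec vJ)"

lemma atoms_weight_row [simp]: "atoms weight_row =
    {Get vX aW vQ, Put aW vQ vY, Inc vQ, Dec vJ} \<union> atoms mult"
  by (auto simp: weight_row_def)

lemma runs_weight_row:
  assumes "vr s vJ \<le> Z"
    and "\<And>q. vr s vQ \<le> q \<Longrightarrow> q < vr s vQ + vr s vJ \<Longrightarrow> ar s aW q \<le> Z"
  shows "runs Z weight_row s (\<lambda>s'. vr s' vQ = vr s vQ + vr s vJ \<and>
    (\<forall>q. ar s' aW q = (if vr s vQ \<le> q \<and> q < vr s vQ + vr s vJ then ar s aW q * vr s vK
                                                  else ar s aW q)))"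
  unfolding weight_row_def
proof (rule runs_While[where f = "\<lambda>s. vr s vJ" and
      I = "\<lambda>s'. vr s' vQ + vr s' vJ = vr s vQ + vr s vJ \<and> vr s vQ \<le> vr s' vQ \<and>
        (\<forall>q. ar s' aW q = (if vr s vQ \<le> q \<and> q < vr s' vQ then ar s aW q * vr s vK
                                                  else ar s aW q))"], goal_cases)
  case (2 s1)
  note fr = frame_rules[OF 2(2)]
  \<comment> \<open>The entry at \<open>vQ\<close> is not yet scaled, hence at most
    \<open>Z\<close>, as counting it down in \<open>mult\<close> requires.\<close>
  have *: "ar s1 aW (vr s1 vQ) = ar s aW (vr s1 vQ)"
    using 2 by simp
  have le: "vr (atom_exec (Get vX aW vQ) s1) vX \<le> Z"
    using 2(1,3) by (simp add: * assms(2))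
  show ?case
  proof (rule runs_Atom_Seq, rule runs_Seq, rule runs_frame[OF runs_mult[OF le]], goal_cases)
    case (1 s2)
    note fr2 = frame_rules[OF 1(2)]
    show ?case
      using 1(1) 2(1,3) by (intro runs_Atom_Seq) (auto simp: fr fr2 * less_Suc_eq)
  qed
qed (use assms in auto)

text \<open>\<open>vK\<close> is the scaling factor \<open>B ^ i\<close> of the current row and,
  after \<open>n\<close> rounds, the table width. The row of owners lies beyond the scaled
  ones.\<close>

definition weights :: "nat \<Rightarrow> com" where
  "weights n =
    SetC vK 1 ;; SetC vQ 0 ;; SetC vI 0 ;; SetC vR n ;;
    While vR
      (Put aP vI vK ;; Inc vI ;; SetV vJ vM ;; weight_row ;;
       SetV vX vB ;; mult ;; SetV vK vY ;; Dec vR)"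

lemma runs_weights:
  assumes "n \<le> Z" and "vr s vM \<le> Z" and "vr s vB \<le> Z" and "\<And>q. q < n * vr s vM \<Longrightarrow> ar s aW q \<le> Z"
  shows "runs Z (weights n) s (\<lambda>s'. vr s' vK = vr s vB ^ n \<and> vr s' vQ = n * vr s vM \<and>
    (\<forall>i<n. ar s' aP i = vr s vB ^ i) \<and>
    (\<forall>q. ar s' aW q = (if q < n * vr s vM then ar s aW q * vr s vB ^ (q div vr s vM)
                        else ar s aW q)))"
  unfolding weights_def
proof (intro runs_Atom_Seq, rule runs_While[where f = "\<lambda>s. vr s vR" and
      I = "\<lambda>s'. vr s' vI + vr s' vR = n \<and> vr s' vK = vr s vB ^ vr s' vI \<and>
    vr s' vQ = vr s' vI * vr s vM \<and> (\<forall>i<vr s' vI. ar s' aP i = vr s vB ^ i) \<and>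
    (\<forall>q. ar s' aW q = (if q < vr s' vI * vr s vM then ar s aW q * vr s vB ^ (q div vr s vM)
                        else ar s aW q))"], goal_cases)
  case (2 s1)
  note fr = frame_rules[OF 2(2)] and inv1 = 2(1) and nz = 2(3)
  let ?i = "vr s1 vI" and ?m = "vr s vM"
  have i: "?i < n" "Suc ?i * ?m \<le> n * ?m"
    using 2(1,3) by (auto intro!: mult_right_mono simp del: mult_Suc)
  have W: "ar s1 aW q \<le> Z" if "?i * ?m \<le> q" "q < ?i * ?m + ?m" for q
    using 2(1) that i by (simp add: assms(4))
  show ?case
  proof (intro runs_Atom_Seq, rule runs_Seq, rule runs_frame[OF runs_weight_row], goal_cases)
    case 1
    show ?case by (simp add: fr assms)
  next
    case (2 q)
    then show ?case using inv1 W by (simp add: fr)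
  next
    case (3 s2)
    note fr2 = frame_rules[OF 3(2)]
    have row: "q div ?m = ?i" if "?i * ?m \<le> q" "q < ?i * ?m + ?m" for q
      using that by (intro div_nat_eqI) (auto simp: algebra_simps)
    show ?case
    proof (rule runs_Atom_Seq, rule runs_Seq, rule runs_frame[OF runs_mult], goal_cases)
      case 1
      show ?case by (simp add: fr fr2 assms)
    next
      case (2 s3)
      note fr3 = frame_rules[OF 2(2)]
      show ?case
        using 2(1) 3(1) inv1 nz row
        by (intro runs_Atom_Seq) (auto simp: fr fr2 fr3 less_Suc_eq)
    qed
  qed
qed (use assms in auto)

text \<open>\<open>vQ\<close> is expected at \<open>n * m\<close>, where \<open>weights\<close>
  stops and the owners begin. Owners are numbered from 1 in the input, hence the decrement.\<close>

definition endowment :: com where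
  "endowment =
    SetC vZ 0 ;; SetV vR vM ;;
    While vR
      (Get vI aW vQ ;; Dec vI ;; SetV vX vI ;; SetV vY vZ ;; add_rows ;;
       Get vX aW vY ;; Get vY aE vI ;; AddV vX vX vY ;; Put aE vI vX ;;
       Inc vQ ;; Inc vZ ;; Dec vR)"

text \<open>\<open>vR\<close> is the object to be given away; \<open>vZ\<close> starts there and
  descends with stride \<open>m\<close> through its weights. \<open>vI\<close> is increased before
  it is stored, so that agent 0 leaves a nonzero mark.\<close>

definition process_position :: "nat \<Rightarrow> com" where
  "process_position n =
    SetV vZ vR ;; SetC vI 0 ;; SetC vX n ;;
    While vX
      (Get vY aW vZ ;; AddV vY vY vK ;; AddV vY vY vP ;; Inc vI ;;
       Put aT vY vI ;; Put aX vY vP ;; AddV vZ vZ vM ;; Dec vX)"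

definition process_row :: "nat \<Rightarrow> com" where
  "process_row n =
    While vJ (Get vX aT vP ;; If vX (process_position n) (SetC vX 0) ;; Inc vP ;; Dec vJ)"

text \<open>\<open>vP\<close> is not reset between rows, so it ends at \<open>m * K\<close>, where
  the row of complete assignments begins and \<open>search\<close> takes over.\<close>

definition dynamic_programming :: "nat \<Rightarrow> com" where
  "dynamic_programming n =
    SetC vX 1 ;; SetC vP 0 ;; Put aT vP vX ;; SetV vR vM ;;
    While vR (Dec vR ;; SetV vJ vK ;; process_row n)"

text \<open>Truncated subtraction serves as order test: \<open>Suc a - q\<close> is nonzero exactly
  if \<open>q \<le> a\<close>.\<close>

definition reduce :: com where
  "reduce =
    SetV vY vA ;; Inc vY ;; SubV vY vY vQ ;;
    While vY (SubV vA vA vQ ;; SetV vY vA ;; Inc vY ;; SubV vY vY vQ)"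

text \<open>Going from the highest digit down lets one accumulator suffice: when agent
  \<open>i\<close> is tested, \<open>vA\<close> is the code modulo \<open>B ^ Suc i\<close>, and
  reducing it modulo \<open>B ^ i\<close> prepares the next test.\<close>

definition check_code :: "nat \<Rightarrow> com" where
  "check_code n =
    SetC vX 1 ;; SetV vA vC ;; SetC vI n ;;
    While vI
      (Dec vI ;; Get vY aE vI ;; SubV vY vY vA ;; If vY (SetC vX 0) (SetC vY 0) ;;
       Get vQ aP vI ;; reduce)"

text \<open>Codes are scanned in increasing order, so the last good one is the largest and
  \<open>vZ\<close> is overwritten without any comparison.\<close>

definition search :: "nat \<Rightarrow> com" where
  "search n =
    SetC vC 0 ;; SetC vZ 0 ;; SetV vR vK ;;
    While vR
      (Get vX aT vP ;;
       If vX (check_code n ;; If vX (SetV vZ vP) (SetC vX 0)) (SetC vX 0) ;;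
       Inc vC ;; Inc vP ;; Dec vR)"

text \<open>A mark is the agent's index plus one, which is precisely the owner's number in the
  output.\<close>

definition write_output :: com where
  "write_output =
    SetV vR vM ;; While vR (Get vX aT vZ ;; Wr vX ;; Get vZ aX vZ ;; Dec vR)"

lemma atoms_process_position [simp]: "atoms (process_position n) =
    {SetV vZ vR, SetC vI 0, SetC vX n, Get vY aW vZ, AddV vY vY vK, AddV vY vY vP, Inc vI,
     Put aT vY vI, Put aX vY vP, AddV vZ vZ vM, Dec vX}"
  by (auto simp: process_position_def)

lemma atoms_process_row [simp]: "atoms (process_row n) =
    {Get vX aT vP, SetC vX 0, Inc vP, Dec vJ} \<union> atoms (process_position n)"
  by (auto simp: process_row_def)

lemma atoms_reduce [simp]: "atoms reduce =
    {SetV vY vA, Inc vY, SubV vY vY vQ, SubV vA vA vQ}"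
  by (auto simp: reduce_def)

lemma atoms_check_code [simp]: "atoms (check_code n) =
    {SetC vX 1, SetV vA vC, SetC vI n, Dec vI, Get vY aE vI, SubV vY vY vA, SetC vX 0, SetC vY 0,
     Get vQ aP vI} \<union> atoms reduce"
  by (auto simp: check_code_def)

section \<open>Verification of the phases\<close>

lemma runs_reduce:
  assumes "vr s vA \<le> Z" and "0 < vr s vQ"
  shows "runs Z reduce s (\<lambda>s'. vr s' vA = vr s vA mod vr s vQ)"
  unfolding reduce_def
proof (intro runs_Atom_Seq, rule runs_While[where f = "\<lambda>s. Suc (vr s vA) - vr s vQ" and
      I = "\<lambda>s'. vr s' vA mod vr s vQ = vr s vA mod vr s vQ \<and> vr s' vY = Suc (vr s' vA) - vr s vQ"],
    goal_cases)
  case (2 s1)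
  note fr = frame_rules[OF 2(2)] and inv1 = 2(1) and nz = 2(3)
  have "vr s vQ \<le> vr s1 vA"
    using 2 by auto
  with 2(1) assms(2) show ?case
    by (intro runs_Atom_Seq) (auto simp: fr le_mod_geq)
qed (use assms in \<open>auto simp: frame_rules\<close>)

locale bounded_instance = coded_instance +
  fixes Z :: nat
  assumes bounds: "n \<le> Z" "m \<le> Z" "B \<le> Z" "K \<le> Z"
begin

lemma runs_endowment:
  assumes M: "vr s vM = m" and Q: "vr s vQ = n * m"
    and W: "\<And>i x. i < n \<Longrightarrow> x < m \<Longrightarrow> ar s aW (i * m + x) = wt i x"
    and own: "\<And>x. x < m \<Longrightarrow> ar s aW (n * m + x) = Suc (own x)"
    and E: "\<And>i. ar s aE i = 0"
  shows "runs Z endowment s (\<lambda>s'. \<forall>i<n. ar s' aE i = endowed i * B ^ i)"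
  unfolding endowment_def
proof (intro runs_Atom_Seq, rule runs_While[where f = "\<lambda>s. vr s vR" and
      I = "\<lambda>s. vr s vZ + vr s vR = m \<and> vr s vQ = n * m + vr s vZ \<and>
        (\<forall>i<n. ar s aE i = (\<Sum>x<vr s vZ. if own x = i then wt i x else 0))"], goal_cases)
  case (2 s1)
  note fr = frame_rules[OF 2(2)] and inv1 = 2(1) and nz = 2(3)
  have z: "vr s1 vZ < m" using 2 by simp
  note o = own_less[OF z]
  show ?case
  proof (intro runs_Atom_Seq, rule runs_Seq, rule runs_frame[OF runs_add_rows], goal_cases)
    case 1
    show ?case using 2(1) z own o bounds(1) by (simp add: fr)
  next
    case (2 s2)
    note fr2 = frame_rules[OF 2(2)]
    have "vr s2 vY = own (vr s1 vZ) * m + vr s1 vZ" "vr s2 vI = own (vr s1 vZ)"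
      using 2(1) inv1 z own by (simp_all add: fr fr2 M)
    then show ?case
      using inv1 nz W[OF o z]
      by (intro runs_Atom_Seq) (auto simp: fr fr2)
  qed
next
  case (4 s1)
  note fr = frame_rules[OF 4(2)]
  \<comment> \<open>All weights in the sum belong to agent \<open>i\<close> and share the factor
    \<open>B ^ i\<close>.\<close>
  have "(\<Sum>x<m. if own x = i then wt i x else 0) = endowed i * B ^ i" for i
    unfolding endowed_def wt_def sum_distrib_right by (intro sum.cong) auto
  with 4 show ?case by simp
qed (use assms bounds in auto)

definition weights_stored :: "state \<Rightarrow> bool" where
  "weights_stored s \<longleftrightarrow> vr s vM = m \<and> vr s vK = K \<and> (\<forall>i<n. \<forall>x<m. ar s aW (i * m + x) = wt i x)"

lemma runs_process_position:
  assumes "weights_stored s" and "dp_inv (vr s vP) 0 (ar s aT) (ar s aX)"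
    and "ar s aT (vr s vP) \<noteq> 0" and "vr s vP div K < m" and "vr s vR = m - Suc (vr s vP div K)"
  shows "runs Z (process_position n) s (\<lambda>s'. dp_inv (vr s vP) n (ar s' aT) (ar s' aX))"
  unfolding process_position_def
proof (intro runs_Atom_Seq, rule runs_While[where f = "\<lambda>s. vr s vX" and
      I = "\<lambda>s'. vr s' vI + vr s' vX = n \<and> vr s' vZ = vr s' vI * m + vr s vR \<and>
        dp_inv (vr s vP) (vr s' vI) (ar s' aT) (ar s' aX) \<and> ar s' aT (vr s vP) \<noteq> 0"], goal_cases)
  case (2 s1)
  note fr = frame_rules[OF 2(2)] and inv1 = 2(1) and nz = 2(3)
  let ?p = "vr s vP"
  have i: "vr s1 vI < n" using 2 by simp
  have "vr s vR < m" using assms(4,5) by simp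
  with i have "ar s aW (vr s1 vZ) = wt (vr s1 vI) (vr s vR)"
    using 2(1) assms(1) by (simp add: weights_stored_def)
  then have *: "ar s aW (vr s1 vZ) + vr s vK + ?p = target ?p (vr s1 vI)"
    using assms(1,5) by (simp add: weights_stored_def target_def)
  have "dp_inv ?p (Suc (vr s1 vI)) ((ar s1 aT)(target ?p (vr s1 vI) := Suc (vr s1 vI)))
      ((ar s1 aX)(target ?p (vr s1 vI) := ?p))"
    using 2(1) assms(4) i by (intro dp_inv_step) auto
  with 2(1,3) * assms(1) target_gt[of ?p "vr s1 vI"] show ?case
    by (intro runs_Atom_Seq) (simp add: fr weights_stored_def)
qed (use assms bounds in \<open>auto simp: weights_stored_def\<close>)

lemma runs_process_row:
  assumes "weights_stored s" and "dp_inv (vr s vP) 0 (ar s aT) (ar s aX)"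
    and "vr s vJ = K" and "vr s vP = j * K" and "vr s vR = m - Suc j" and "j < m"
  shows "runs Z (process_row n) s (\<lambda>s'. vr s' vP = Suc j * K \<and>
    dp_inv (vr s' vP) 0 (ar s' aT) (ar s' aX))"
  unfolding process_row_def
proof (rule runs_While[where f = "\<lambda>s. vr s vJ" and
      I = "\<lambda>s. vr s vP + vr s vJ = Suc j * K \<and> j * K \<le> vr s vP \<and>
    dp_inv (vr s vP) 0 (ar s aT) (ar s aX)"], goal_cases)
  case (2 s1)
  note fr = frame_rules[OF 2(2)] and inv1 = 2(1) and nz = 2(3)
  \<comment> \<open>The quotient is constant along the row, so the object in \<open>vR\<close> stays
    the right one.\<close>
  have div: "vr s1 vP div K = j"
    using 2 by (intro div_nat_eqI) (auto simp: algebra_simps)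
  show ?case
  proof (intro runs_Atom_Seq, rule runs_Seq, rule runs_If, goal_cases)
    case 1
    show ?case
    proof (rule runs_frame[OF runs_process_position], goal_cases)
      case (6 s2)
      note fr2 = frame_rules[OF 6(2)]
      show ?case
        using dp_inv_Suc[OF 6(1)] 2(1,3) by (intro runs_Atom_Seq) (auto simp: fr fr2)
    qed (use 1 2(1) assms div in \<open>auto simp: fr weights_stored_def\<close>)
  next
    case 2
    then show ?case
      using dp_inv_Suc_unmarked[of "vr s1 vP" "ar s1 aT" "ar s1 aX"] inv1 nz
      by (auto intro!: runs_Atom_Seq simp: fr)
  qed
qed (use assms bounds in auto)

lemma runs_dynamic_programming:
  assumes "weights_stored s" and "\<And>d. ar s aT d = 0"
  shows "runs Z (dynamic_programming n) s (\<lambda>s'. vr s' vP = m * K \<and>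
    dp_inv (m * K) 0 (ar s' aT) (ar s' aX))"
  unfolding dynamic_programming_def
proof (intro runs_Atom_Seq, rule runs_While[where f = "\<lambda>s. vr s vR" and
      I = "\<lambda>s. vr s vR \<le> m \<and> vr s vP = (m - vr s vR) * K \<and>
    dp_inv (vr s vP) 0 (ar s aT) (ar s aX)"], goal_cases)
  case (2 s1)
  note fr = frame_rules[OF 2(2)] and inv1 = 2(1) and nz = 2(3)
  let ?j = "m - vr s1 vR"
  have *: "Suc ?j = m - (vr s1 vR - 1)" "m - Suc ?j = vr s1 vR - 1" "?j < m"
    using 2 by auto
  show ?case
  proof (intro runs_Atom_Seq, rule runs_frame[OF runs_process_row[where j = ?j]], goal_cases)
    case (7 s2)
    note fr2 = frame_rules[OF 7(2)]
    show ?case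
      using 7(1) 2(1,3) * by (auto simp: fr fr2)
  qed (use 2 assms * in \<open>auto simp: fr weights_stored_def\<close>)
next
  case 1
  show ?case using assms by (simp add: weights_stored_def dp_inv_init)
qed (use assms bounds in \<open>auto simp: weights_stored_def\<close>)

lemma runs_check_code:
  assumes "vr s vC < K" and "\<And>i. i < n \<Longrightarrow> ar s aP i = B ^ i"
    and "\<And>i. i < n \<Longrightarrow> ar s aE i = endowed i * B ^ i"
  shows "runs Z (check_code n) s (\<lambda>s'. vr s' vX \<noteq> 0 \<longleftrightarrow> good (vr s vC))"
  unfolding check_code_def
proof (intro runs_Atom_Seq, rule runs_While[where f = "\<lambda>s. vr s vI" and
      I = "\<lambda>s'. vr s' vA = vr s vC mod B ^ vr s' vI \<and> vr s' vI \<le> n \<and>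
        (vr s' vX \<noteq> 0 \<longleftrightarrow>
          (\<forall>i<n. vr s' vI \<le> i \<longrightarrow> endowed i * B ^ i \<le> vr s vC mod B ^ Suc i))"], goal_cases)
  case 1
  \<comment> \<open>A code below \<open>B ^ n\<close> is its own remainder, which is the invariant
    at \<open>vI = n\<close>.\<close>
  show ?case using assms(1) by (simp add: K_def)
next
  case (2 s1)
  note fr = frame_rules[OF 2(2)] and inv1 = 2(1) and nz = 2(3)
  obtain i where i: "vr s1 vI = Suc i" "i < n"
    using 2 by (cases "vr s1 vI") auto
  let ?c = "vr s vC"
  have P: "ar s1 aP i = B ^ i" and E: "ar s1 aE i = endowed i * B ^ i"
    using i(2) assms(2,3) by (simp_all add: fr)
  have A: "vr s1 vA = ?c mod B ^ Suc i" "vr s1 vA \<le> Z" "vr s1 vA mod B ^ i = ?c mod B ^ i"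
  proof -
    show *: "vr s1 vA = ?c mod B ^ Suc i" using 2(1) i by simp
    then show "vr s1 vA mod B ^ i = ?c mod B ^ i"
      by (simp add: mod_mod_cancel)
    have "vr s1 vA \<le> ?c" unfolding * by (rule mod_less_eq_dividend)
    with assms(1) bounds(4) show "vr s1 vA \<le> Z" by linarith
  qed
  have X: "vr s1 vX \<noteq> 0 \<and> endowed i * B ^ i \<le> vr s1 vA \<longleftrightarrow>
      (\<forall>k<n. i \<le> k \<longrightarrow> endowed k * B ^ k \<le> ?c mod B ^ Suc k)"
  proof -
    have "(\<forall>k<n. i \<le> k \<longrightarrow> Q k) \<longleftrightarrow> (\<forall>k<n. Suc i \<le> k \<longrightarrow> Q k) \<and> Q i" for Q
      using i(2) by (metis Suc_leD Suc_leI le_eq_less_or_eq)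
    with 2(1) i A(1) show ?thesis by simp
  qed
  \<comment> \<open>Both outcomes of the test continue with the same reduction, so it is treated
    once for every state that either branch can leave.\<close>
  have red: "runs Z reduce s2 (\<lambda>s''. (vr s'' vA = ?c mod B ^ vr s'' vI \<and> vr s'' vI \<le> n \<and>
        (vr s'' vX \<noteq> 0 \<longleftrightarrow>
          (\<forall>i<n. vr s'' vI \<le> i \<longrightarrow> endowed i * B ^ i \<le> ?c mod B ^ Suc i))) \<and>
        vr s'' vI < vr s1 vI)"
    if "vr s2 vA = vr s1 vA" "vr s2 vQ = B ^ i" "vr s2 vI = i"
      "vr s2 vX \<noteq> 0 \<longleftrightarrow> vr s1 vX \<noteq> 0 \<and> endowed i * B ^ i \<le> vr s1 vA" for s2
  proof (rule runs_frame[OF runs_reduce], goal_cases)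
    case (3 s3)
    note fr3 = frame_rules[OF 3(2)]
    show ?case
      using 3(1) that X A i by (simp add: fr3)
  qed (use that A B_pos in auto)
  show ?case
  proof (intro runs_Atom_Seq, rule runs_Seq, rule runs_If, goal_cases)
    case 1
    show ?case
      unfolding runs_Atom by (intro runs_Atom_Seq red) (use 1 i P E in auto)
  next
    case 2
    show ?case
      unfolding runs_Atom by (intro runs_Atom_Seq red) (use 2 i P E in auto)
  qed
qed (use bounds in \<open>auto simp: good_def\<close>)

text \<open>Requiring a result only relative to each good marked column makes the invariant vacuous
  until a candidate appears, so the initial \<open>vZ = 0\<close> needs no special case.\<close>

lemma runs_search:
  assumes "vr s vP = m * K" and "vr s vK = K" and "\<And>i. i < n \<Longrightarrow> ar s aP i = B ^ i"
    and "\<And>i. i < n \<Longrightarrow> ar s aE i = endowed i * B ^ i"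
  shows "runs Z (search n) s (\<lambda>s'. \<forall>c<K. ar s aT (m * K + c) \<noteq> 0 \<longrightarrow> good c \<longrightarrow>
    (\<exists>c'<K. vr s' vZ = m * K + c' \<and> c \<le> c' \<and> ar s aT (m * K + c') \<noteq> 0 \<and> good c'))"
  unfolding search_def
proof (intro runs_Atom_Seq, rule runs_While[where f = "\<lambda>s. vr s vR" and
      I = "\<lambda>s'. vr s' vC + vr s' vR = K \<and> vr s' vP = m * K + vr s' vC \<and>
        (\<forall>c<vr s' vC. ar s aT (m * K + c) \<noteq> 0 \<longrightarrow> good c \<longrightarrow>
          (\<exists>c'<K. vr s' vZ = m * K + c' \<and> c \<le> c' \<and> ar s aT (m * K + c') \<noteq> 0 \<and> good c'))"],
    goal_cases)
  case (2 s1)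
  note fr = frame_rules[OF 2(2)] and inv1 = 2(1) and nz = 2(3)
  have c: "vr s1 vC < K" using 2 by simp
  show ?case
  proof (intro runs_Atom_Seq, rule runs_Seq, rule runs_If, goal_cases)
    case 1
    show ?case
    proof (rule runs_Seq, rule runs_frame[OF runs_check_code], goal_cases)
      case (4 s2)
      note fr2 = frame_rules[OF 4(2)]
      show ?case
        using 1 2(1,3) 4(1) c
        by (auto intro!: runs_If runs_Atom_Seq simp: fr fr2 less_Suc_eq)
    qed (use c assms in \<open>auto simp: fr\<close>)
  next
    case 2
    then show ?case
      using inv1 nz by (auto intro!: runs_Atom_Seq simp: fr less_Suc_eq)
  qed
qed (use assms bounds in auto)

lemma runs_write_output:
  assumes inv: "dp_inv p j (ar s aT) (ar s aX)" and "vr s vM = m"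
    and "ar s aT (vr s vZ) \<noteq> 0" and "vr s vZ div K = m"
  shows "runs Z write_output s (\<lambda>s'.
    outq s' = outq s @ map Suc (trace (ar s aT) (ar s aX) m (vr s vZ)))"
  unfolding write_output_def
proof (intro runs_Atom_Seq, rule runs_While[where f = "\<lambda>s. vr s vR" and
      I = "\<lambda>s'. ar s aT (vr s' vZ) \<noteq> 0 \<and> vr s' vZ div K = vr s' vR \<and>
    outq s' @ map Suc (trace (ar s aT) (ar s aX) (vr s' vR) (vr s' vZ)) =
    outq s @ map Suc (trace (ar s aT) (ar s aX) m (vr s vZ))"], goal_cases)
  case (2 s1)
  note fr = frame_rules[OF 2(2)] and inv1 = 2(1) and nz = 2(3)
  obtain k where k: "vr s1 vR = Suc k"
    using 2(3) by (cases "vr s1 vR") auto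
  with 2(1) dp_pred[OF inv, of "vr s1 vZ" k] show ?case
    by (intro runs_Atom_Seq) (auto simp: fr)
qed (use assms bounds in auto)

end

section \<open>Composition of the phases\<close>

definition allocation_program :: "nat \<Rightarrow> com" where
  "allocation_program n =
    read_input n ;; weights n ;; endowment ;; dynamic_programming n ;; search n ;; write_output"

lemma atoms_read_input [simp]: "atoms (read_input n) =
    {Rd vM, SetC vL 0, SetC vR (Suc n), AddV vL vL vM, Dec vR, SetC vB 1, SetC vQ 0, Rd vX,
     Put aW vQ vX, Inc vQ, AddV vB vB vX, Dec vL}"
  by (auto simp: read_input_def)

lemma atoms_weights [simp]: "atoms (weights n) =
    {SetC vK 1, SetC vQ 0, SetC vI 0, SetC vR n, Put aP vI vK, Inc vI, SetV vJ vM, SetV vX vB,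
     SetV vK vY, Dec vR} \<union> atoms weight_row \<union> atoms mult"
  by (auto simp: weights_def)

lemma atoms_endowment [simp]: "atoms endowment =
    {SetC vZ 0, SetV vR vM, Get vI aW vQ, Dec vI, SetV vX vI, SetV vY vZ, Get vX aW vY,
     Get vY aE vI, AddV vX vX vY, Put aE vI vX, Inc vQ, Inc vZ, Dec vR} \<union> atoms add_rows"
  by (auto simp: endowment_def)

lemma atoms_dynamic_programming [simp]: "atoms (dynamic_programming n) =
    {SetC vX 1, SetC vP 0, Put aT vP vX, SetV vR vM, Dec vR, SetV vJ vK} \<union> atoms (process_row n)"
  by (auto simp: dynamic_programming_def)

lemma atoms_search [simp]: "atoms (search n) =
    {SetC vC 0, SetC vZ 0, SetV vR vK, Get vX aT vP, SetV vZ vP, SetC vX 0, Inc vC, Inc vP,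
     Dec vR} \<union> atoms (check_code n)"
  by (auto simp: search_def)

context bounded_instance
begin

text \<open>Completeness places every good full list in row \<open>m\<close>, so the selected column
  is at least its code; tracing back yields a list that attains this column.\<close>

lemma search_best:
  assumes inv: "dp_inv (m * K) 0 T X"
    and z: "\<forall>c<K. T (m * K + c) \<noteq> 0 \<longrightarrow> good c \<longrightarrow>
      (\<exists>c'<K. z = m * K + c' \<and> c \<le> c' \<and> T (m * K + c') \<noteq> 0 \<and> good c')"
  shows "T z \<noteq> 0 \<and> z div K = m \<and> best (trace T X m z)"
proof -
  have z': "\<exists>c'<K. z = m * K + c' \<and> code l \<le> c' \<and> T z \<noteq> 0 \<and> good c'"
    if "valid l" "length l = m" "good (code l)" for l
    using z code_less[OF that(1)] dp_complete[OF inv that(1)] pos_eq[OF that(1)] that by auto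
  from endowment_good z' obtain c where c: "c < K" "z = m * K + c" "T z \<noteq> 0" "good c"
    by blast
  then have d: "z div K = m" by simp
  let ?l = "trace T X m z"
  have l: "valid ?l" "length ?l = m" "pos ?l = z"
    using dp_trace[OF inv c(3) d] by blast+
  have code: "code ?l = c"
    using pos_eq[OF l(1)] l c(2) by simp
  have "code l' \<le> code ?l" if "valid l'" "length l' = m" "good (code l')" for l'
    using z'[OF that] c(2) code by auto
  then show ?thesis
    using l c(3,4) d code unfolding best_def by blast
qed

lemma runs_allocation_program:
  assumes len: "length ys = Suc n * m" and Z: "Suc n \<le> Z" "length ys \<le> Z"
    and B: "B = Suc (sum_list ys)"
    and U: "\<And>i x. i < n \<Longrightarrow> x < m \<Longrightarrow> ys ! (i * m + x) = U i x"
    and own: "\<And>x. x < m \<Longrightarrow> ys ! (n * m + x) = Suc (own x)"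
  shows "runs Z (allocation_program n) (init_state (m # ys)) (\<lambda>s. \<exists>l. best l \<and> outq s = map Suc l)"
  unfolding allocation_program_def
proof (rule runs_Seq, rule runs_frame[OF runs_read_input[OF len Z]], goal_cases)
  case 1
  show ?case by (simp add: init_state_def)
next
  case (2 s1)
  note r1 = 2(1) and f1 = frame_rules[OF 2(2)]
  have "ys ! q \<le> Z" if "q < length ys" for q
    using member_le_sum_list[of "ys ! q" ys] that B bounds(3) by simp
  moreover have ix: "i * m + x < n * m" if "i < n" "x < m" for i x
  proof -
    have "i * m + x < Suc i * m" using that by simp
    also have "\<dots> \<le> n * m" using that by (intro mult_right_mono) auto
    finally show ?thesis .
  qed
  moreover have M1: "vr s1 vM = m" and B1: "vr s1 vB = B"
    using r1 B by simp_all
  ultimately have W: "runs Z (weights n) s1 (\<lambda>s'. vr s' vK = K \<and> vr s' vQ = n * m \<and>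
      (\<forall>i<n. ar s' aP i = B ^ i) \<and>
      (\<forall>q. ar s' aW q = (if q < n * m then ar s1 aW q * B ^ (q div m) else ar s1 aW q)))"
    unfolding K_def using bounds(1-3) r1 len
    by (intro runs_weights[of n Z s1, unfolded M1 B1]) auto
  show ?case
  proof (rule runs_Seq, rule runs_frame[OF W], goal_cases)
    case (1 s2)
    note r2 = 1(1) and f2 = frame_rules[OF 1(2)]
    have wt: "ar s2 aW (i * m + x) = wt i x" if "i < n" "x < m" for i x
      using that r1 r2 U ix[OF that] len by (simp add: wt_def)
    have own': "ar s2 aW (n * m + x) = Suc (own x)" if "x < m" for x
      using that r1 r2 own len by simp
    show ?case
    proof (rule runs_Seq, rule runs_frame[OF runs_endowment], goal_cases)
      case 1
      show ?case using r1 by (simp add: f2)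
    next
      case 2
      show ?case using r2 by simp
    next
      case (3 i x)
      then show ?case by (rule wt)
    next
      case (4 x)
      then show ?case by (rule own')
    next
      case 5
      show ?case by (simp add: f1 f2 init_state_def)
    next
      case (6 s3)
      note r3 = 6(1) and f3 = frame_rules[OF 6(2)]
      have ws: "weights_stored s3"
        using r1 r2 wt by (simp add: weights_stored_def f2 f3)
      show ?case
      proof (rule runs_Seq, rule runs_frame[OF runs_dynamic_programming[OF ws]], goal_cases)
        case 1
        show ?case by (simp add: f1 f2 f3 init_state_def)
      next
        case (2 s4)
        note r4 = 2(1) and f4 = frame_rules[OF 2(2)]
        show ?case
        proof (rule runs_Seq, rule runs_frame[OF runs_search], goal_cases)
          case (5 s5)
          note f5 = frame_rules[OF 5(2)]
          \<comment> \<open>The search only reads the tables, so the invariant still holds for the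
            output phase.\<close>
          have TX: "ar s5 aT = ar s4 aT" "ar s5 aX = ar s4 aX"
            by (simp_all add: f5)
          have *: "ar s4 aT (vr s5 vZ) \<noteq> 0 \<and> vr s5 vZ div K = m \<and>
              best (trace (ar s4 aT) (ar s4 aX) m (vr s5 vZ))"
            by (rule search_best) (use r4 5(1) in auto)
          have "outq s5 = []" "vr s5 vM = m"
            using r1 by (simp_all add: f1 f2 f3 f4 f5 init_state_def)
          with * r4 show ?case
            by (intro runs_conseq[OF runs_write_output[where p = "m * K" and j = 0]])
              (auto simp: TX)
        qed (use r2 r3 r4 in \<open>simp_all add: f3 f4\<close>)
      qed
    qed
  qed
qed

end

section \<open>Assignments as lists of owners\<close>

lemma concat_nth:
  assumes "\<And>i. i < n \<Longrightarrow> length (f i) = m"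
  shows "length (concat (map f [0..<n])) = n * m"
    and "i < n \<Longrightarrow> x < m \<Longrightarrow> concat (map f [0..<n]) ! (i * m + x) = f i ! x"
proof -
  have len: "length (concat (map f [0..<n])) = n * m"
    if "\<And>i. i < n \<Longrightarrow> length (f i) = m" for n
    using that by (induction n) auto
  show "length (concat (map f [0..<n])) = n * m"
    using assms by (rule len)
  show "concat (map f [0..<n]) ! (i * m + x) = f i ! x" if "i < n" "x < m"
    using assms that
  proof (induction n)
    case (Suc n)
    have "length (concat (map f [0..<n])) = n * m"
      using Suc.prems by (intro len) simp
    moreover have "i * m + x < n * m" if "i < n"
    proof -
      have "i * m + x < Suc i * m" using Suc.prems by simp
      also have "\<dots> \<le> n * m" using that by (intro mult_right_mono) auto
      finally show ?thesis .
    qed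
    ultimately show ?case
      using Suc by (auto simp: nth_append less_Suc_eq)
  qed simp
qed

locale allocation_instance =
  fixes n m :: nat and u :: "nat \<Rightarrow> nat \<Rightarrow> nat" and e :: "nat \<Rightarrow> nat set"
  assumes endowment: "assignment {1..n} {1..m} e"
begin

definition owner_index :: "(nat \<Rightarrow> nat set) \<Rightarrow> nat \<Rightarrow> nat" where
  "owner_index q x = owner n q (Suc x) - 1"

definition owners :: "(nat \<Rightarrow> nat set) \<Rightarrow> nat list" where
  "owners q = map (owner_index q) [0..<m]"

definition input_tail :: "nat list" where
  "input_tail = concat (map (\<lambda>i. map (\<lambda>x. u (Suc i) (Suc x)) [0..<m]) [0..<n]) @
     map (\<lambda>x. owner n e (Suc x)) [0..<m]"

definition base :: nat where
  "base = Suc (sum_list input_tail)"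

lemma encode_eq: "encode_instance n m u e = m # input_tail"
proof -
  have *: "map f [1..<k + 1] = map (\<lambda>i. f (Suc i)) [0..<k]" for f :: "nat \<Rightarrow> 'a" and k
    by (simp add: map_Suc_upt[symmetric] del: upt_Suc)
  show ?thesis
    unfolding encode_instance_def encode_assignment_def input_tail_def * ..
qed

lemma sum_list_Suc: "sum_list (map Suc xs) = sum_list xs + length xs"
  by (induction xs) auto

lemma length_input_tail: "length input_tail = Suc n * m"
  unfolding input_tail_def by (simp add: concat_nth(1)[where m = m])

lemma nth_input_tail_utility:
  assumes "i < n" "x < m"
  shows "input_tail ! (i * m + x) = u (Suc i) (Suc x)"
proof -
  have "i * m + x < Suc i * m" using assms by simp
  also have "\<dots> \<le> n * m" using assms by (intro mult_right_mono) auto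
  finally show ?thesis
    unfolding input_tail_def using assms
    by (simp add: nth_append concat_nth[where m = m])
qed

lemma owner_bounds:
  assumes "assignment {1..n} {1..m} q" and "x < m"
  shows "0 < owner n q (Suc x)" and "owner n q (Suc x) \<le> n" and "Suc x \<in> q (owner n q (Suc x))"
  using owner_eq_iff[OF assms(1), of "Suc x" "owner n q (Suc x)"] assms(2) by auto

lemma nth_input_tail_owner:
  assumes "x < m"
  shows "input_tail ! (n * m + x) = Suc (owner_index e x)"
  unfolding input_tail_def owner_index_def using assms owner_bounds(1)[OF endowment assms]
  by (simp add: nth_append concat_nth[where m = m])

text \<open>The utilities of one agent fill a contiguous block of the input, so their sum is at most
  that of the whole tail and below \<open>base\<close>.\<close>

sublocale coded_instance n m base "\<lambda>i x. u (Suc i) (Suc x)" "owner_index e"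
proof
  fix i assume i: "i < n"
  have "(\<Sum>x<m. u (Suc i) (Suc x)) = (\<Sum>x<m. input_tail ! (i * m + x))"
    using i by (simp add: nth_input_tail_utility)
  also have "\<dots> = sum ((!) input_tail) ((+) (i * m) ` {..<m})"
    by (simp add: sum.reindex)
  also have "\<dots> \<le> sum ((!) input_tail) {0..<length input_tail}"
  proof (rule sum_mono2)
    have "i * m + x < Suc n * m" if "x < m" for x
    proof -
      have "i * m + x < Suc i * m" using that by simp
      also have "\<dots> \<le> Suc n * m" using i by (intro mult_right_mono) auto
      finally show ?thesis .
    qed
    then show "(+) (i * m) ` {..<m} \<subseteq> {0..<length input_tail}"
      by (auto simp: length_input_tail)
  qed auto
  also have "\<dots> = sum_list input_tail"
    by (simp add: sum_list_sum_nth)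
  finally show "(\<Sum>x<m. u (Suc i) (Suc x)) < base"
    by (simp add: base_def)
next
  fix x assume "x < m"
  with owner_bounds[OF endowment this] show "owner_index e x < n"
    by (auto simp: owner_index_def)
qed (simp add: base_def)

lemma valid_owners:
  assumes "assignment {1..n} {1..m} q"
  shows "valid (owners q)" and "length (owners q) = m"
  using owner_bounds(1,2)[OF assms] by (fastforce simp: owners_def owner_index_def valid_def)+

lemma util_owners:
  assumes "assignment {1..n} {1..m} q" and "i < n"
  shows "util (owners q) i = utility u (Suc i) (q (Suc i))"
proof -
  have "q (Suc i) \<subseteq> {1..m}"
    using assms by (auto simp: assignment_def)
  then have "q (Suc i) = {x \<in> {1..m}. owner n q x = Suc i}"
    using assms(2) by (auto simp: owner_eq_iff[OF assms(1)])
  then have "utility u (Suc i) (q (Suc i)) =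
      (\<Sum>x\<in>{1..m}. if owner n q x = Suc i then u (Suc i) x else 0)"
    unfolding utility_def by (simp only: sum.inter_filter finite_atLeastAtMost)
  also have "\<dots> = (\<Sum>x<m. if owner n q (Suc x) = Suc i then u (Suc i) (Suc x) else 0)"
    by (simp add: sum.atLeast1_atMost_eq)
  also have "\<dots> = (\<Sum>x<m. if owners q ! x = i then u (Suc i) (Suc x) else 0)"
  proof (rule sum.cong)
    fix x assume "x \<in> {..<m}"
    then have "owner n q (Suc x) = Suc i \<longleftrightarrow> owners q ! x = i"
      using owner_bounds(1)[OF assms(1), of x] by (auto simp: owners_def owner_index_def)
    then show "(if owner n q (Suc x) = Suc i then u (Suc i) (Suc x) else 0) =
        (if owners q ! x = i then u (Suc i) (Suc x) else 0)"
      by simp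
  qed simp
  finally show ?thesis
    by (simp add: util_full valid_owners(2)[OF assms(1)])
qed

lemma endowed_eq: "i < n \<Longrightarrow> endowed i = utility u (Suc i) (e (Suc i))"
  unfolding util_owners[OF endowment, symmetric] endowed_def
  by (simp add: util_full owners_def)

section \<open>From lists back to assignments\<close>

definition assign :: "nat list \<Rightarrow> nat \<Rightarrow> nat set" where
  "assign l i = {x \<in> {1..m}. Suc (l ! (x - 1)) = i}"

lemma assign:
  assumes "valid l" and "length l = m"
  shows "assignment {1..n} {1..m} (assign l)"
    and "owners (assign l) = l"
    and "encode_assignment n m (assign l) = map Suc l"
proof -
  have less: "l ! x < n" if "x < m" for x
  proof -
    have "l ! x \<in> set l" using assms(2) that by simp
    then show ?thesis using assms(1) by (auto simp: valid_def)
  qed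
  show as: "assignment {1..n} {1..m} (assign l)"
    unfolding assignment_def disjoint_family_on_def assign_def
    using less by (auto simp: Suc_le_eq)
  have owner: "owner n (assign l) (Suc x) = Suc (l ! x)" if "x < m" for x
    using that less by (auto simp: owner_eq_iff[OF as] assign_def Suc_le_eq)
  show "owners (assign l) = l"
    using assms(2) by (intro nth_equalityI) (auto simp: owners_def owner_index_def owner)
  show "encode_assignment n m (assign l) = map Suc l"
    unfolding encode_assignment_def
    using assms(2) by (intro nth_equalityI) (auto simp: owner simp del: upt_Suc)
qed

text \<open>Every competing assignment \<open>q\<close> is represented by the list
  \<open>owners q\<close>, to which \<open>best_undominated\<close> applies.\<close>

lemma best_assign:
  assumes "best l"
  shows "pareto_optimal {1..n} {1..m} u (assign l)" and "individually_rational {1..n} u e (assign l)"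
proof -
  have l: "valid l" "length l = m" "good (code l)"
    using assms by (auto simp: best_def)
  note as = assign[OF l(1,2)]
  have util: "utility u i (assign l i) = util l (i - 1)" if "i \<in> {1..n}" for i
  proof -
    have "i - 1 < n" "Suc (i - 1) = i" using that by auto
    then show ?thesis
      using util_owners[OF as(1), of "i - 1"] as(2) by simp
  qed
  show "individually_rational {1..n} u e (assign l)"
    unfolding individually_rational_def
  proof
    fix i assume i: "i \<in> {1..n}"
    then have "i - 1 < n" "Suc (i - 1) = i" by auto
    then show "utility u i (e i) \<le> utility u i (assign l i)"
      using l(3) good_code[OF l(1)] endowed_eq[of "i - 1"] util[OF i] by metis
  qed
  have False if q: "assignment {1..n} {1..m} q" "pareto_dominates {1..n} u q (assign l)" for q
  proof -
    have utilq: "utility u i (q i) = util (owners q) (i - 1)" if "i \<in> {1..n}" for i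
    proof -
      have "i - 1 < n" "Suc (i - 1) = i" using that by auto
      then show ?thesis
        using util_owners[OF q(1), of "i - 1"] by simp
    qed
    have le: "util l i \<le> util (owners q) i" if "i < n" for i
    proof -
      have i: "Suc i \<in> {1..n}" using that by simp
      then have "utility u (Suc i) (assign l (Suc i)) \<le> utility u (Suc i) (q (Suc i))"
        using q(2) unfolding pareto_dominates_def by blast
      then show ?thesis
        using util[OF i] utilq[OF i] by simp
    qed
    obtain i where i: "i \<in> {1..n}" "utility u i (assign l i) < utility u i (q i)"
      using q(2) unfolding pareto_dominates_def by blast
    have "util (owners q) (i - 1) \<le> util l (i - 1)"
      using i(1) by (intro best_undominated[OF assms valid_owners[OF q(1)] le]) auto
    with i util utilq show False by simp
  qed
  then show "pareto_optimal {1..n} {1..m} u (assign l)"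
    unfolding pareto_optimal_def by blast
qed

lemma program_correct:
  defines "xs \<equiv> encode_instance n m u e"
  shows "\<exists>p. assignment {1..n} {1..m} p \<and> pareto_optimal {1..n} {1..m} u p \<and>
    individually_rational {1..n} u e p \<and>
    computes_within (compile 0 (allocation_program n)) xs (encode_assignment n m p)
      (poly (time_poly (allocation_program n)) ((unary_size xs + n + 1) ^ (n + 1)))"
proof -
  define a where "a = unary_size xs + n + 1"
  \<comment> \<open>\<open>a\<close> exceeds \<open>n\<close>, the input length and
    \<open>sum_list input_tail\<close>, so \<open>a ^ n\<close> bounds the table width; the extra
    factor keeps \<open>a \<le> Z\<close> even for \<open>n = 0\<close>.\<close>
  define Z where "Z = a ^ (n + 1)"
  have size: "unary_size xs = Suc m + (sum_list input_tail + length input_tail)"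
    unfolding xs_def encode_eq unary_size_def by (simp add: sum_list_Suc)
  have aZ: "a \<le> Z"
    unfolding Z_def by (rule self_le_power) (auto simp: a_def)
  have "base ^ n \<le> a ^ n"
    by (intro power_mono) (auto simp: a_def size base_def)
  also have "\<dots> \<le> Z"
    unfolding Z_def by (intro power_increasing) (auto simp: a_def)
  finally have "K \<le> Z" by (simp add: K_def)
  then interpret bounded_instance n m base "\<lambda>i x. u (Suc i) (Suc x)"
      "owner_index e" Z
    using aZ by unfold_locales (auto simp: a_def size base_def)
  have "runs Z (allocation_program n) (init_state (m # input_tail))
      (\<lambda>s. \<exists>l. best l \<and> outq s = map Suc l)"
    using aZ
    by (intro runs_allocation_program length_input_tail nth_input_tail_utility nth_input_tail_owner)
      (auto simp: a_def size base_def)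
  then obtain t s l where *: "big (allocation_program n) (init_state xs) t s"
      "t \<le> poly (time_poly (allocation_program n)) Z" "best l" "outq s = map Suc l"
    unfolding runs_def xs_def encode_eq by blast
  from *(3) have l: "valid l" "length l = m" by (auto simp: best_def)
  have "computes_within (compile 0 (allocation_program n)) xs (outq s)
      (poly (time_poly (allocation_program n)) Z)"
    by (rule computes_within_mono[OF big_computes_within[OF *(1)] *(2)])
  then show ?thesis
    using assign[OF l] best_assign[OF *(3)] *(4) unfolding Z_def a_def by metis
qed

end

theorem theorem4:
  fixes n :: nat
  shows "\<exists>P. pseudo_polynomial_time_on (instances n) P \<and>
    (\<forall>m (u :: nat \<Rightarrow> nat \<Rightarrow> nat) e. assignment {1..n} {1..m} e \<longrightarrow>
      (\<exists>p. assignment {1..n} {1..m} p \<and>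
           pareto_optimal {1..n} {1..m} u p \<and>
           individually_rational {1..n} u e p \<and>
           computes P (encode_instance n m u e) (encode_assignment n m p)))"
proof (rule exI, intro conjI allI impI)
  let ?P = "compile 0 (allocation_program n)"
  \<comment> \<open>\<open>[:n + 1, 1:]\<close> is X + n + 1; its power is the loop bound as a
    polynomial in the input size, of a degree depending only on the constant
    \<open>n\<close>.\<close>
  let ?b = "pcompose (time_poly (allocation_program n)) ([:n + 1, 1:] ^ (n + 1))"
  have b: "poly ?b k = poly (time_poly (allocation_program n)) ((k + n + 1) ^ (n + 1))" for k
    by (simp only: poly_pcompose poly_power) (simp add: algebra_simps)
  have correct: "\<exists>p. assignment {1..n} {1..m} p \<and> pareto_optimal {1..n} {1..m} u p \<and>
      individually_rational {1..n} u e p \<and>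
      computes_within ?P (encode_instance n m u e) (encode_assignment n m p)
        (poly ?b (unary_size (encode_instance n m u e)))"
    if "assignment {1..n} {1..m} e" for m :: nat and u :: "nat \<Rightarrow> nat \<Rightarrow> nat" and e
    unfolding b by (rule allocation_instance.program_correct) (unfold_locales, rule that)
  then show "pseudo_polynomial_time_on (instances n) ?P"
    unfolding pseudo_polynomial_time_on_def instances_def by blast
  fix m :: nat and u :: "nat \<Rightarrow> nat \<Rightarrow> nat" and e
  assume "assignment {1..n} {1..m} e"
  from correct[OF this, of u] show "\<exists>p. assignment {1..n} {1..m} p \<and>
      pareto_optimal {1..n} {1..m} u p \<and> individually_rational {1..n} u e p \<and>
      computes ?P (encode_instance n m u e) (encode_assignment n m p)"
    unfolding computes_def by blast
qed

end
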